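(* Let $X$ be a proper $\mathrm{CAT}(0)$ space and let $H=\mathrm{Isom}(X)$ contain a uniform lattice. Let $(A,\mathcal{A},\psi)$ be a graph of $H$-lattices with locally-finite Bass--Serre tree $\mathcal{T}$ and fundamental group $\Gamma$. Suppose $T=\mathrm{Aut}(\mathcal{T})$ is non-discrete and unimodular. Assume $A$ is finite, that each local group $(A_\sigma,\psi|_{A_\sigma})$ is covirtually a uniform $H$-lattice, and that the kernel $\mathrm{Ker}(\psi|_{A_\sigma})$ acts faithfully on $\mathcal{T}$. Then $\Gamma$ is quasi-isometric to $X\times\mathcal{T}$.
   Context: Standing assumptions: all $\mathrm{CAT}(0)$ spaces have finite-dimensional Tits boundary; actions on graphs and polyhedral complexes are admissible (each element fixes pointwise every cell it stabilises). A $G$-lattice, for $G$ locally compact with Haar measure $\mu$, is a discrete subgroup $\Gamma\le G$ with $\mu(G/\Gamma)<\infty$; uniform if $G/\Gamma$ is compact. A pair $(B,\phi)$ is covirtually a (uniform) $H$-lattice if $\phi:B\to H$ is a homomorphism with finite kernel and image a (uniform) $H$-lattice. $\mathrm{Comm}_G(B)=\{g\in G:B\cap B^g$ has finite index in $B$ and in $B^g\}$; subgroups $B,C\le G$ are commensurable in $G$ if $B\cap C$ has finite index in both. A graph of groups $(A,\mathcal{A})$ has vertex groups $A_v$, edge groups $A_e=A_{\bar e}$ and monomorphisms $\alpha_e:A_e\to A_{\iota(e)}$, where $\iota(e)$ is the initial vertex of the oriented edge $e$. Its path group is generated by the $A_v$ and elements $t_e$ subject to the relations of the $A_v$, $t_{\bar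 e}=t_e^{-1}$ and $t_e\alpha_{\bar e}(g)t_e^{-1}=\alpha_e(g)$. A morphism $\psi$ to a group $H$ consists of homomorphisms $\psi_v:A_v\to H$, $\psi_e=\psi_{\bar e}:A_e\to H$ and elements $h_v,h_e\in H$ with $\psi_v\alpha_e=\mathrm{Ad}(h_v^{-1}h_e)\psi_e$ for $v=\iota(e)$, where $\mathrm{Ad}(x)(g)=xgx^{-1}$; it induces a homomorphism on the path group ($g\in A_v\mapsto h_v\psi_v(g)h_v^{-1}$, $t_e\mapsto h_eh_{\bar e}^{-1}$) and on $\pi_1(\mathcal{A})$, also denoted $\psi$. A graph of $H$-lattices $(A,\mathcal{A},\psi)$ is a graph of groups with a morphism $\psi$ to $H$ such that: (i) each $(A_\sigma,\psi_\sigma)$, $\sigma$ a vertex or edge, is covirtually an $H$-lattice; (ii) the local groups are commensurable in $\pi_1(\mathcal{A})$ and their images are commensurable in $H$; (iii) each $t_e$ is mapped under $\psi$ into $\mathrm{Comm}_H(\psi_e(A_e))$.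
   Formalization: The formal statement also assumes that Isom(X) acts cocompactly on X; without it the claim fails, e.g. X=[0,∞) with trivial isometry group, A one vertex with two loops and trivial local groups, where Γ is free of rank 2. *)

theory Defs
  imports "HOL-Analysis.Analysis" "HOL-Algebra.Coset" "HOL-Algebra.Generated_Groups"
    "HOL-Algebra.Bij"
begin

section \<open>CAT(0) spaces\<close>

definition geodesic_segment :: "(real \<Rightarrow> 'x::metric_space) \<Rightarrow> 'x \<Rightarrow> 'x \<Rightarrow> bool" where
  "geodesic_segment c x y \<longleftrightarrow>
     c 0 = x \<and> c (dist x y) = y \<and>
     (\<forall>s\<in>{0..dist x y}. \<forall>t\<in>{0..dist x y}. dist (c s) (c t) = \<bar>s - t\<bar>)"

text \<open>Two points on different sides of a geodesic triangle lie on two sides with a common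
  vertex, here called \<open>p\<close>; for two points on one side the comparison inequality is an equality.\<close>

definition CAT0 :: "'x::metric_space itself \<Rightarrow> bool" where
  "CAT0 _ \<longleftrightarrow>
     (\<forall>x y::'x. \<exists>c. geodesic_segment c x y) \<and>
     (\<forall>(p::'x) q r c c' (p'::real^2) q' r' s t u v.
        geodesic_segment c p q \<and> geodesic_segment c' p r \<and>
        dist p' q' = dist p q \<and> dist p' r' = dist p r \<and> dist q' r' = dist q r \<and>
        s \<in> {0..dist p q} \<and> t \<in> {0..dist p r} \<and>
        u \<in> closed_segment p' q' \<and> dist p' u = s \<and>
        v \<in> closed_segment p' r' \<and> dist p' v = t
        \<longrightarrow> dist (c s) (c' t) \<le> dist u v)"

section \<open>The Tits boundary and its dimension\<close>

definition geodesic_ray :: "(real \<Rightarrow> 'x::metric_space) \<Rightarrow> bool" where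
  "geodesic_ray c \<longleftrightarrow> (\<forall>s\<ge>0. \<forall>t\<ge>0. dist (c s) (c t) = \<bar>s - t\<bar>)"

definition asymptotic_rays :: "(real \<Rightarrow> 'x::metric_space) \<Rightarrow> (real \<Rightarrow> 'x) \<Rightarrow> bool" where
  "asymptotic_rays c c' \<longleftrightarrow> (\<exists>K. \<forall>t\<ge>0. dist (c t) (c' t) \<le> K)"

definition boundary_at_infinity :: "(real \<Rightarrow> 'x::metric_space) set set" where
  "boundary_at_infinity =
     {{c'. geodesic_ray c' \<and> asymptotic_rays c c'} |c. geodesic_ray c}"

definition comparison_angle :: "'x::metric_space \<Rightarrow> 'x \<Rightarrow> 'x \<Rightarrow> real" where
  "comparison_angle x y z =
     arccos (((dist x y)\<^sup>2 + (dist x z)\<^sup>2 - (dist y z)\<^sup>2) / (2 * dist x y * dist x z))"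

definition alexandrov_angle :: "(real \<Rightarrow> 'x::metric_space) \<Rightarrow> (real \<Rightarrow> 'x) \<Rightarrow> ereal" where
  "alexandrov_angle c c' =
     Limsup (at_right 0 \<times>\<^sub>F at_right 0) (\<lambda>(s, t). ereal (comparison_angle (c 0) (c s) (c' t)))"

definition angular_metric ::
    "(real \<Rightarrow> 'x::metric_space) set \<Rightarrow> (real \<Rightarrow> 'x) set \<Rightarrow> ereal" where
  "angular_metric \<xi> \<eta> = Sup {alexandrov_angle c c' |c c'. c \<in> \<xi> \<and> c' \<in> \<eta> \<and> c 0 = c' 0}"

text \<open>The Tits metric is the (extended) length metric of the angular metric.\<close>

definition angular_path ::
    "(real \<Rightarrow> (real \<Rightarrow> 'x::metric_space) set) \<Rightarrow> bool" where
  "angular_path \<gamma> \<longleftrightarrow>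
     (\<forall>t\<in>{0..1}. \<gamma> t \<in> boundary_at_infinity) \<and>
     (\<forall>t\<in>{0..1}. \<forall>\<epsilon>>0. \<exists>\<delta>>0. \<forall>s\<in>{0..1}.
        \<bar>s - t\<bar> < \<delta> \<longrightarrow> angular_metric (\<gamma> s) (\<gamma> t) < ereal \<epsilon>)"

definition angular_length ::
    "(real \<Rightarrow> (real \<Rightarrow> 'x::metric_space) set) \<Rightarrow> ereal" where
  "angular_length \<gamma> =
     Sup {(\<Sum>i<n. angular_metric (\<gamma> (\<tau> i)) (\<gamma> (\<tau> (Suc i)))) |n \<tau>.
            \<tau> 0 = 0 \<and> \<tau> n = 1 \<and> (\<forall>i<n. \<tau> i \<le> \<tau> (Suc i))}"

definition tits_metric ::
    "(real \<Rightarrow> 'x::metric_space) set \<Rightarrow> (real \<Rightarrow> 'x) set \<Rightarrow> ereal" where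
  "tits_metric \<xi> \<eta> =
     Inf {angular_length \<gamma> |\<gamma>. angular_path \<gamma> \<and> \<gamma> 0 = \<xi> \<and> \<gamma> 1 = \<eta>}"

definition tits_boundary :: "(real \<Rightarrow> 'x::metric_space) set topology" where
  "tits_boundary =
     topology_generated_by
       {{\<eta> \<in> boundary_at_infinity. tits_metric \<xi> \<eta> < ereal r} |\<xi> r.
          \<xi> \<in> boundary_at_infinity \<and> r > 0}"

definition covering_dim_le :: "'a topology \<Rightarrow> nat \<Rightarrow> bool" where
  "covering_dim_le K n \<longleftrightarrow>
     (\<forall>\<U>. finite \<U> \<and> (\<forall>U\<in>\<U>. openin K U) \<and> \<Union>\<U> = topspace K \<longrightarrow>
        (\<exists>\<V>. (\<forall>V\<in>\<V>. openin K V) \<and> \<Union>\<V> = topspace K \<and>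
             (\<forall>V\<in>\<V>. \<exists>U\<in>\<U>. V \<subseteq> U) \<and>
             (\<forall>x\<in>topspace K. finite {V \<in> \<V>. x \<in> V} \<and> card {V \<in> \<V>. x \<in> V} \<le> n + 1)))"

text \<open>Dimension is meant in the sense of Kleiner's geometric dimension: the supremum of the
  covering dimensions of compact subsets.\<close>

definition finite_dimensional_tits_boundary :: "'x::metric_space itself \<Rightarrow> bool" where
  "finite_dimensional_tits_boundary _ \<longleftrightarrow>
     (\<exists>n. \<forall>K. compactin (tits_boundary :: (real \<Rightarrow> 'x) set topology) K \<longrightarrow>
              covering_dim_le (subtopology tits_boundary K) n)"

section \<open>Haar measure and lattices\<close>

text \<open>A topological group is given by a group \<open>G\<close> together with a topology \<open>\<tau>\<close> whose underlying
  set is \<open>carrier G\<close>.\<close>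

definition radon_measure_on :: "'g topology \<Rightarrow> 'g measure \<Rightarrow> bool" where
  "radon_measure_on \<tau> \<mu> \<longleftrightarrow>
     space \<mu> = topspace \<tau> \<and> sets \<mu> = sigma_sets (topspace \<tau>) {U. openin \<tau> U} \<and>
     (\<forall>K\<in>sets \<mu>. compactin \<tau> K \<longrightarrow> emeasure \<mu> K < \<infinity>) \<and>
     (\<forall>B\<in>sets \<mu>. emeasure \<mu> B = Inf {emeasure \<mu> U |U. openin \<tau> U \<and> B \<subseteq> U}) \<and>
     (\<forall>U. openin \<tau> U \<longrightarrow>
        emeasure \<mu> U = Sup {emeasure \<mu> K |K. K \<in> sets \<mu> \<and> compactin \<tau> K \<and> K \<subseteq> U})"

definition right_haar_measure :: "'g monoid \<Rightarrow> 'g topology \<Rightarrow> 'g measure \<Rightarrow> bool" where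
  "right_haar_measure G \<tau> \<mu> \<longleftrightarrow>
     radon_measure_on \<tau> \<mu> \<and> emeasure \<mu> (space \<mu>) \<noteq> 0 \<and>
     (\<forall>g\<in>carrier G. \<forall>B\<in>sets \<mu>. emeasure \<mu> (B #>\<^bsub>G\<^esub> g) = emeasure \<mu> B)"

definition left_haar_measure :: "'g monoid \<Rightarrow> 'g topology \<Rightarrow> 'g measure \<Rightarrow> bool" where
  "left_haar_measure G \<tau> \<mu> \<longleftrightarrow>
     radon_measure_on \<tau> \<mu> \<and> emeasure \<mu> (space \<mu>) \<noteq> 0 \<and>
     (\<forall>g\<in>carrier G. \<forall>B\<in>sets \<mu>. emeasure \<mu> (g <#\<^bsub>G\<^esub> B) = emeasure \<mu> B)"

definition unimodular :: "'g monoid \<Rightarrow> 'g topology \<Rightarrow> bool" where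
  "unimodular G \<tau> \<longleftrightarrow> (\<exists>\<mu>. left_haar_measure G \<tau> \<mu> \<and> right_haar_measure G \<tau> \<mu>)"

definition discrete_in :: "'g topology \<Rightarrow> 'g set \<Rightarrow> bool" where
  "discrete_in \<tau> S \<longleftrightarrow> subtopology \<tau> S = discrete_topology S"

text \<open>For a discrete subgroup \<open>L\<close> the measure of \<open>G/L\<close> induced by a right Haar measure is the
  measure of any Borel set of representatives of the left cosets \<open>gL\<close>.\<close>

definition lattice_in :: "'g monoid \<Rightarrow> 'g topology \<Rightarrow> 'g set \<Rightarrow> bool" where
  "lattice_in G \<tau> L \<longleftrightarrow>
     subgroup L G \<and> discrete_in \<tau> L \<and>
     (\<exists>\<mu> D. right_haar_measure G \<tau> \<mu> \<and> D \<in> sets \<mu> \<and>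
            (\<forall>g\<in>carrier G. \<exists>!d. d \<in> D \<and> d \<in> g <#\<^bsub>G\<^esub> L) \<and> emeasure \<mu> D < \<infinity>)"

definition quotient_topology :: "'a topology \<Rightarrow> ('a \<Rightarrow> 'b) \<Rightarrow> 'b topology" where
  "quotient_topology \<tau> f =
     topology (\<lambda>U. U \<subseteq> f ` topspace \<tau> \<and> openin \<tau> {x \<in> topspace \<tau>. f x \<in> U})"

lemma openin_quotient_topology:
  "openin (quotient_topology \<tau> f) U \<longleftrightarrow>
     U \<subseteq> f ` topspace \<tau> \<and> openin \<tau> {x \<in> topspace \<tau>. f x \<in> U}"
proof -
  let ?O = "\<lambda>U. U \<subseteq> f ` topspace \<tau> \<and> openin \<tau> {x \<in> topspace \<tau>. f x \<in> U}"
  have "?O (S \<inter> T)" if "?O S" "?O T" for S T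
  proof -
    have "{x \<in> topspace \<tau>. f x \<in> S \<inter> T} = {x \<in> topspace \<tau>. f x \<in> S} \<inter> {x \<in> topspace \<tau>. f x \<in> T}"
      by auto
    with that show ?thesis by auto
  qed
  moreover have "?O (\<Union>\<K>)" if "\<forall>K\<in>\<K>. ?O K" for \<K>
  proof -
    have "{x \<in> topspace \<tau>. f x \<in> \<Union>\<K>} = (\<Union>K\<in>\<K>. {x \<in> topspace \<tau>. f x \<in> K})"
      by auto
    with that show ?thesis by auto
  qed
  ultimately have "istopology ?O"
    unfolding istopology_def by blast
  then show ?thesis
    by (simp add: quotient_topology_def topology_inverse')
qed

definition uniform_lattice_in :: "'g monoid \<Rightarrow> 'g topology \<Rightarrow> 'g set \<Rightarrow> bool" where
  "uniform_lattice_in G \<tau> L \<longleftrightarrow>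
     lattice_in G \<tau> L \<and> compact_space (quotient_topology \<tau> (\<lambda>g. g <#\<^bsub>G\<^esub> L))"

definition covirtually_lattice ::
    "'h monoid \<Rightarrow> 'h topology \<Rightarrow> 'g monoid \<Rightarrow> ('g \<Rightarrow> 'h) \<Rightarrow> bool" where
  "covirtually_lattice H \<tau> B \<phi> \<longleftrightarrow>
     \<phi> \<in> hom B H \<and> finite (kernel B H \<phi>) \<and> lattice_in H \<tau> (\<phi> ` carrier B)"

definition covirtually_uniform_lattice ::
    "'h monoid \<Rightarrow> 'h topology \<Rightarrow> 'g monoid \<Rightarrow> ('g \<Rightarrow> 'h) \<Rightarrow> bool" where
  "covirtually_uniform_lattice H \<tau> B \<phi> \<longleftrightarrow>
     \<phi> \<in> hom B H \<and> finite (kernel B H \<phi>) \<and> uniform_lattice_in H \<tau> (\<phi> ` carrier B)"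

section \<open>Commensurability\<close>

definition conjugate :: "('g, 'm) monoid_scheme \<Rightarrow> 'g \<Rightarrow> 'g set \<Rightarrow> 'g set" where
  "conjugate G g B = (\<lambda>b. g \<otimes>\<^bsub>G\<^esub> b \<otimes>\<^bsub>G\<^esub> inv\<^bsub>G\<^esub> g) ` B"

definition finite_index :: "('g, 'm) monoid_scheme \<Rightarrow> 'g set \<Rightarrow> 'g set \<Rightarrow> bool" where
  "finite_index G K B \<longleftrightarrow> K \<subseteq> B \<and> finite ((\<lambda>b. K #>\<^bsub>G\<^esub> b) ` B)"

definition commensurable :: "('g, 'm) monoid_scheme \<Rightarrow> 'g set \<Rightarrow> 'g set \<Rightarrow> bool" where
  "commensurable G B C \<longleftrightarrow> finite_index G (B \<inter> C) B \<and> finite_index G (B \<inter> C) C"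

definition commensurator :: "('g, 'm) monoid_scheme \<Rightarrow> 'g set \<Rightarrow> 'g set" where
  "commensurator G B = {g \<in> carrier G. commensurable G B (conjugate G (inv\<^bsub>G\<^esub> g) B)}"

section \<open>Graphs\<close>

text \<open>Graphs in the sense of Serre: \<open>edges\<close> are oriented, \<open>bar\<close> reverses the orientation and
  \<open>ini\<close> is the initial vertex.\<close>

record ('v, 'e) sgraph =
  verts :: "'v set"
  edges :: "'e set"
  ini :: "'e \<Rightarrow> 'v"
  bar :: "'e \<Rightarrow> 'e"

definition serre_graph :: "('v, 'e, 'z) sgraph_scheme \<Rightarrow> bool" where
  "serre_graph A \<longleftrightarrow>
     (\<forall>e\<in>edges A. ini A e \<in> verts A \<and> bar A e \<in> edges A \<and> bar A e \<noteq> e \<and> bar A (bar A e) = e)"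

abbreviation ter :: "('v, 'e, 'z) sgraph_scheme \<Rightarrow> 'e \<Rightarrow> 'v" where
  "ter A e \<equiv> ini A (bar A e)"

fun edge_path :: "('v, 'e, 'z) sgraph_scheme \<Rightarrow> 'v \<Rightarrow> 'e list \<Rightarrow> 'v \<Rightarrow> bool" where
  "edge_path A a [] b \<longleftrightarrow> a \<in> verts A \<and> a = b"
| "edge_path A a (e # es) b \<longleftrightarrow> e \<in> edges A \<and> ini A e = a \<and> edge_path A (ter A e) es b"

definition connected_graph :: "('v, 'e, 'z) sgraph_scheme \<Rightarrow> bool" where
  "connected_graph A \<longleftrightarrow>
     verts A \<noteq> {} \<and> (\<forall>a\<in>verts A. \<forall>b\<in>verts A. \<exists>es. edge_path A a es b)"

definition finite_graph :: "('v, 'e, 'z) sgraph_scheme \<Rightarrow> bool" where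
  "finite_graph A \<longleftrightarrow> finite (verts A) \<and> finite (edges A)"

definition locally_finite_graph :: "('v, 'e, 'z) sgraph_scheme \<Rightarrow> bool" where
  "locally_finite_graph A \<longleftrightarrow> (\<forall>v\<in>verts A. finite {e \<in> edges A. ini A e = v})"

definition graph_dist :: "('v, 'e, 'z) sgraph_scheme \<Rightarrow> 'v \<Rightarrow> 'v \<Rightarrow> real" where
  "graph_dist A a b = real (LEAST n. \<exists>es. edge_path A a es b \<and> length es = n)"

definition graph_aut_group ::
    "('v, 'e, 'z) sgraph_scheme \<Rightarrow> (('v \<Rightarrow> 'v) \<times> ('e \<Rightarrow> 'e)) monoid" where
  "graph_aut_group A =
     (BijGroup (verts A) \<times>\<times> BijGroup (edges A))
       \<lparr>carrier := {(f, g). f \<in> Bij (verts A) \<and> g \<in> Bij (edges A) \<and>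
          (\<forall>e\<in>edges A. ini A (g e) = f (ini A e) \<and> bar A (g e) = g (bar A e))}\<rparr>"

text \<open>The topology of pointwise convergence on the discrete sets of vertices and edges, which is
  the compact-open topology.\<close>

definition graph_aut_topology ::
    "('v, 'e, 'z) sgraph_scheme \<Rightarrow> (('v \<Rightarrow> 'v) \<times> ('e \<Rightarrow> 'e)) topology" where
  "graph_aut_topology A =
     subtopology
       (prod_topology (product_topology (\<lambda>_. discrete_topology (verts A)) (verts A))
                      (product_topology (\<lambda>_. discrete_topology (edges A)) (edges A)))
       (carrier (graph_aut_group A))"

subsection \<open>Geometric realisation\<close>

text \<open>All edges have length 1; \<open>Inr (e, t)\<close> is the point on the edge \<open>e\<close> at distance \<open>t\<close> from
  its initial vertex. A point may have several names (such as \<open>(e, t)\<close> and \<open>(bar e, 1 - t)\<close>),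
  which are at distance 0, so that the realisation is presented as a pseudometric space.\<close>

definition realisation :: "('v, 'e, 'z) sgraph_scheme \<Rightarrow> ('v + 'e \<times> real) set" where
  "realisation A = Inl ` verts A \<union> Inr ` (edges A \<times> {0..1})"

fun dist_to_vertex :: "('v, 'e, 'z) sgraph_scheme \<Rightarrow> 'v + 'e \<times> real \<Rightarrow> 'v \<Rightarrow> real" where
  "dist_to_vertex A (Inl v) w = graph_dist A v w"
| "dist_to_vertex A (Inr (e, t)) w =
     min (t + graph_dist A (ini A e) w) (1 - t + graph_dist A (ter A e) w)"

fun dist_via_vertex ::
    "('v, 'e, 'z) sgraph_scheme \<Rightarrow> 'v + 'e \<times> real \<Rightarrow> 'v + 'e \<times> real \<Rightarrow> real" where
  "dist_via_vertex A p (Inl w) = dist_to_vertex A p w"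
| "dist_via_vertex A p (Inr (f, t)) =
     min (dist_to_vertex A p (ini A f) + t) (dist_to_vertex A p (ter A f) + (1 - t))"

fun realisation_dist ::
    "('v, 'e, 'z) sgraph_scheme \<Rightarrow> 'v + 'e \<times> real \<Rightarrow> 'v + 'e \<times> real \<Rightarrow> real" where
  "realisation_dist A (Inr (e, s)) (Inr (f, t)) =
     (let d = dist_via_vertex A (Inr (e, s)) (Inr (f, t)) in
      if f = e then min \<bar>s - t\<bar> d
      else if f = bar A e then min \<bar>s - (1 - t)\<bar> d
      else d)"
| "realisation_dist A p q = dist_via_vertex A p q"

section \<open>Graphs of groups\<close>

record ('v, 'e, 'a, 'b) graph_of_groups = "('v, 'e) sgraph" +
  vgroup :: "'v \<Rightarrow> 'a monoid"
  egroup :: "'e \<Rightarrow> 'b monoid"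
  emono :: "'e \<Rightarrow> 'b \<Rightarrow> 'a"

definition graph_of_groups :: "('v, 'e, 'a, 'b) graph_of_groups \<Rightarrow> bool" where
  "graph_of_groups A \<longleftrightarrow>
     serre_graph A \<and> connected_graph A \<and>
     (\<forall>v\<in>verts A. group (vgroup A v)) \<and>
     (\<forall>e\<in>edges A. group (egroup A e) \<and> egroup A (bar A e) = egroup A e \<and>
        emono A e \<in> mon (egroup A e) (vgroup A (ini A e)))"

datatype ('v, 'e, 'a) letter = VLetter 'v 'a | ELetter 'e

fun letter_ok :: "('v, 'e, 'a, 'b) graph_of_groups \<Rightarrow> ('v, 'e, 'a) letter \<Rightarrow> bool" where
  "letter_ok A (VLetter v g) \<longleftrightarrow> v \<in> verts A \<and> g \<in> carrier (vgroup A v)"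
| "letter_ok A (ELetter e) \<longleftrightarrow> e \<in> edges A"

definition path_words :: "('v, 'e, 'a, 'b) graph_of_groups \<Rightarrow> ('v, 'e, 'a) letter list set" where
  "path_words A = {w. \<forall>x\<in>set w. letter_ok A x}"

text \<open>The congruence on words generated by the defining relations of the path group. Every
  generator has an inverse among the generators, so no formal inverses are needed.\<close>

inductive path_equiv ::
    "('v, 'e, 'a, 'b) graph_of_groups \<Rightarrow> ('v, 'e, 'a) letter list \<Rightarrow> ('v, 'e, 'a) letter list \<Rightarrow> bool"
  for A where
  refl: "w \<in> path_words A \<Longrightarrow> path_equiv A w w"
| sym: "path_equiv A w w' \<Longrightarrow> path_equiv A w' w"
| trans: "path_equiv A w w' \<Longrightarrow> path_equiv A w' w'' \<Longrightarrow> path_equiv A w w''"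
| vertex_mult: "\<lbrakk>u \<in> path_words A; w \<in> path_words A; v \<in> verts A;
      g \<in> carrier (vgroup A v); h \<in> carrier (vgroup A v)\<rbrakk> \<Longrightarrow>
    path_equiv A (u @ [VLetter v g, VLetter v h] @ w) (u @ [VLetter v (g \<otimes>\<^bsub>vgroup A v\<^esub> h)] @ w)"
| vertex_one: "\<lbrakk>u \<in> path_words A; w \<in> path_words A; v \<in> verts A\<rbrakk> \<Longrightarrow>
    path_equiv A (u @ [VLetter v \<one>\<^bsub>vgroup A v\<^esub>] @ w) (u @ w)"
| edge_inverse: "\<lbrakk>u \<in> path_words A; w \<in> path_words A; e \<in> edges A\<rbrakk> \<Longrightarrow>
    path_equiv A (u @ [ELetter e, ELetter (bar A e)] @ w) (u @ w)"
| edge_conj: "\<lbrakk>u \<in> path_words A; w \<in> path_words A; e \<in> edges A; g \<in> carrier (egroup A e)\<rbrakk> \<Longrightarrow>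
    path_equiv A
      (u @ [ELetter e, VLetter (ter A e) (emono A (bar A e) g), ELetter (bar A e)] @ w)
      (u @ [VLetter (ini A e) (emono A e g)] @ w)"

type_synonym ('v, 'e, 'a) path_elt = "('v, 'e, 'a) letter list set"

definition path_class ::
    "('v, 'e, 'a, 'b) graph_of_groups \<Rightarrow> ('v, 'e, 'a) letter list \<Rightarrow> ('v, 'e, 'a) path_elt" where
  "path_class A w = {w'. path_equiv A w w'}"

definition path_group :: "('v, 'e, 'a, 'b) graph_of_groups \<Rightarrow> ('v, 'e, 'a) path_elt monoid" where
  "path_group A =
     \<lparr>carrier = path_class A ` path_words A,
      mult = (\<lambda>C D. path_class A ((SOME w. w \<in> C) @ (SOME w. w \<in> D))),
      one = path_class A []\<rparr>"

text \<open>The words \<open>g\<^sub>0 t\<^sub>1 g\<^sub>1 \<dots> t\<^sub>n g\<^sub>n\<close> carried by an edge path from \<open>a\<close> to \<open>b\<close>; vertex letters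
  may also be missing or repeated, which does not affect the set of elements represented.\<close>

fun word_along :: "('v, 'e, 'a, 'b) graph_of_groups \<Rightarrow> 'v \<Rightarrow> ('v, 'e, 'a) letter list \<Rightarrow> 'v \<Rightarrow> bool" where
  "word_along A a [] b \<longleftrightarrow> a \<in> verts A \<and> a = b"
| "word_along A a (VLetter v g # w) b \<longleftrightarrow>
     v = a \<and> v \<in> verts A \<and> g \<in> carrier (vgroup A v) \<and> word_along A a w b"
| "word_along A a (ELetter e # w) b \<longleftrightarrow>
     e \<in> edges A \<and> ini A e = a \<and> word_along A (ter A e) w b"

definition paths_between ::
    "('v, 'e, 'a, 'b) graph_of_groups \<Rightarrow> 'v \<Rightarrow> 'v \<Rightarrow> ('v, 'e, 'a) path_elt set" where
  "paths_between A a b = path_class A ` {w. word_along A a w b}"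

definition fundamental_group ::
    "('v, 'e, 'a, 'b) graph_of_groups \<Rightarrow> 'v \<Rightarrow> ('v, 'e, 'a) path_elt monoid" where
  "fundamental_group A a = (path_group A)\<lparr>carrier := paths_between A a a\<rparr>"

definition vertex_subgroup ::
    "('v, 'e, 'a, 'b) graph_of_groups \<Rightarrow> 'v \<Rightarrow> ('v, 'e, 'a) path_elt set" where
  "vertex_subgroup A v = (\<lambda>g. path_class A [VLetter v g]) ` carrier (vgroup A v)"

definition edge_subgroup ::
    "('v, 'e, 'a, 'b) graph_of_groups \<Rightarrow> 'e \<Rightarrow> ('v, 'e, 'a) path_elt set" where
  "edge_subgroup A e =
     (\<lambda>g. path_class A [VLetter (ini A e) (emono A e g)]) ` carrier (egroup A e)"

text \<open>The local groups as subgroups of the fundamental group at \<open>a\<close>: a local group at \<open>v\<close> is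
  transported to \<open>a\<close> along a path element from \<open>a\<close> to \<open>v\<close>. Different path elements give
  conjugate subgroups, and all of them are included.\<close>

definition local_subgroups ::
    "('v, 'e, 'a, 'b) graph_of_groups \<Rightarrow> 'v \<Rightarrow> ('v, 'e, 'a) path_elt set set" where
  "local_subgroups A a =
     {conjugate (path_group A) p (vertex_subgroup A v) |p v.
        v \<in> verts A \<and> p \<in> paths_between A a v} \<union>
     {conjugate (path_group A) p (edge_subgroup A e) |p e.
        e \<in> edges A \<and> p \<in> paths_between A a (ini A e)}"

subsection \<open>The Bass--Serre tree\<close>

text \<open>Vertices are the cosets \<open>p A\<^sub>v\<close> with \<open>p\<close> a path element from \<open>a\<close> to \<open>v\<close>, edges are the
  cosets \<open>p \<alpha>\<^sub>e(A\<^sub>e)\<close> with \<open>p\<close> a path element from \<open>a\<close> to the initial vertex of \<open>e\<close>; the reverse of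
  \<open>p \<alpha>\<^sub>e(A\<^sub>e)\<close> is \<open>p \<alpha>\<^sub>e(A\<^sub>e) t\<^sub>e\<close>, the coset of \<open>p t\<^sub>e\<close> modulo the image of the edge group at the
  other end. The fundamental group acts by left multiplication.\<close>

definition bass_serre_tree ::
    "('v, 'e, 'a, 'b) graph_of_groups \<Rightarrow> 'v \<Rightarrow>
     ('v \<times> ('v, 'e, 'a) path_elt set, 'e \<times> ('v, 'e, 'a) path_elt set) sgraph" where
  "bass_serre_tree A a =
     \<lparr>verts = {(v, p <#\<^bsub>path_group A\<^esub> vertex_subgroup A v) |v p.
                 v \<in> verts A \<and> p \<in> paths_between A a v},
      edges = {(e, p <#\<^bsub>path_group A\<^esub> edge_subgroup A e) |e p.
                 e \<in> edges A \<and> p \<in> paths_between A a (ini A e)},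
      ini = (\<lambda>(e, C). (ini A e, C <#>\<^bsub>path_group A\<^esub> vertex_subgroup A (ini A e))),
      bar = (\<lambda>(e, C). (bar A e, C #>\<^bsub>path_group A\<^esub> path_class A [ELetter e]))\<rparr>"

definition tree_action ::
    "('v, 'e, 'a, 'b) graph_of_groups \<Rightarrow> ('v, 'e, 'a) path_elt \<Rightarrow>
     's \<times> ('v, 'e, 'a) path_elt set \<Rightarrow> 's \<times> ('v, 'e, 'a) path_elt set" where
  "tree_action A x = (\<lambda>(\<sigma>, C). (\<sigma>, x <#\<^bsub>path_group A\<^esub> C))"

definition acts_faithfully_on_tree ::
    "('v, 'e, 'a, 'b) graph_of_groups \<Rightarrow> 'v \<Rightarrow> ('v, 'e, 'a) path_elt set \<Rightarrow> bool" where
  "acts_faithfully_on_tree A a K \<longleftrightarrow>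
     (\<forall>x\<in>K. (\<forall>y\<in>verts (bass_serre_tree A a). tree_action A x y = y) \<and>
            (\<forall>y\<in>edges (bass_serre_tree A a). tree_action A x y = y) \<longrightarrow>
            x = \<one>\<^bsub>path_group A\<^esub>)"

section \<open>Morphisms to a group and graphs of lattices\<close>

record ('v, 'e, 'a, 'b, 'h) gog_morphism =
  vhom :: "'v \<Rightarrow> 'a \<Rightarrow> 'h"
  ehom :: "'e \<Rightarrow> 'b \<Rightarrow> 'h"
  velt :: "'v \<Rightarrow> 'h"
  eelt :: "'e \<Rightarrow> 'h"

definition morphism_to_group ::
    "('v, 'e, 'a, 'b) graph_of_groups \<Rightarrow> 'h monoid \<Rightarrow> ('v, 'e, 'a, 'b, 'h) gog_morphism \<Rightarrow> bool" where
  "morphism_to_group A H \<psi> \<longleftrightarrow>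
     (\<forall>v\<in>verts A. vhom \<psi> v \<in> hom (vgroup A v) H \<and> velt \<psi> v \<in> carrier H) \<and>
     (\<forall>e\<in>edges A. ehom \<psi> e \<in> hom (egroup A e) H \<and> eelt \<psi> e \<in> carrier H \<and>
        (\<forall>g\<in>carrier (egroup A e). ehom \<psi> (bar A e) g = ehom \<psi> e g) \<and>
        (\<forall>g\<in>carrier (egroup A e).
           let x = inv\<^bsub>H\<^esub> velt \<psi> (ini A e) \<otimes>\<^bsub>H\<^esub> eelt \<psi> e in
           vhom \<psi> (ini A e) (emono A e g) = x \<otimes>\<^bsub>H\<^esub> ehom \<psi> e g \<otimes>\<^bsub>H\<^esub> inv\<^bsub>H\<^esub> x))"

fun letter_image ::
    "('v, 'e, 'a, 'b) graph_of_groups \<Rightarrow> 'h monoid \<Rightarrow> ('v, 'e, 'a, 'b, 'h) gog_morphism \<Rightarrow>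
     ('v, 'e, 'a) letter \<Rightarrow> 'h" where
  "letter_image A H \<psi> (VLetter v g) =
     velt \<psi> v \<otimes>\<^bsub>H\<^esub> vhom \<psi> v g \<otimes>\<^bsub>H\<^esub> inv\<^bsub>H\<^esub> velt \<psi> v"
| "letter_image A H \<psi> (ELetter e) = eelt \<psi> e \<otimes>\<^bsub>H\<^esub> inv\<^bsub>H\<^esub> eelt \<psi> (bar A e)"

definition word_image ::
    "('v, 'e, 'a, 'b) graph_of_groups \<Rightarrow> 'h monoid \<Rightarrow> ('v, 'e, 'a, 'b, 'h) gog_morphism \<Rightarrow>
     ('v, 'e, 'a) letter list \<Rightarrow> 'h" where
  "word_image A H \<psi> w = foldr (\<lambda>x y. letter_image A H \<psi> x \<otimes>\<^bsub>H\<^esub> y) w \<one>\<^bsub>H\<^esub>"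

definition induced_hom ::
    "('v, 'e, 'a, 'b) graph_of_groups \<Rightarrow> 'h monoid \<Rightarrow> ('v, 'e, 'a, 'b, 'h) gog_morphism \<Rightarrow>
     ('v, 'e, 'a) path_elt \<Rightarrow> 'h" where
  "induced_hom A H \<psi> C = the_elem (word_image A H \<psi> ` C)"

definition local_images ::
    "('v, 'e, 'a, 'b) graph_of_groups \<Rightarrow> ('v, 'e, 'a, 'b, 'h) gog_morphism \<Rightarrow> 'h set set" where
  "local_images A \<psi> =
     {vhom \<psi> v ` carrier (vgroup A v) |v. v \<in> verts A} \<union>
     {ehom \<psi> e ` carrier (egroup A e) |e. e \<in> edges A}"

definition graph_of_lattices ::
    "('v, 'e, 'a, 'b) graph_of_groups \<Rightarrow> 'h monoid \<Rightarrow> 'h topology \<Rightarrow>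
     ('v, 'e, 'a, 'b, 'h) gog_morphism \<Rightarrow> bool" where
  "graph_of_lattices A H \<tau> \<psi> \<longleftrightarrow>
     graph_of_groups A \<and> morphism_to_group A H \<psi> \<and>
     (\<forall>v\<in>verts A. covirtually_lattice H \<tau> (vgroup A v) (vhom \<psi> v)) \<and>
     (\<forall>e\<in>edges A. covirtually_lattice H \<tau> (egroup A e) (ehom \<psi> e)) \<and>
     (\<forall>a\<in>verts A. \<forall>B\<in>local_subgroups A a. \<forall>C\<in>local_subgroups A a.
        commensurable (fundamental_group A a) B C) \<and>
     (\<forall>B\<in>local_images A \<psi>. \<forall>C\<in>local_images A \<psi>. commensurable H B C) \<and>
     (\<forall>e\<in>edges A. induced_hom A H \<psi> (path_class A [ELetter e])
                     \<in> commensurator H (ehom \<psi> e ` carrier (egroup A e)))"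

section \<open>Isometry groups\<close>

definition isometry_group :: "('x::metric_space \<Rightarrow> 'x) monoid" where
  "isometry_group =
     \<lparr>carrier = {f. bij f \<and> (\<forall>x y. dist (f x) (f y) = dist x y)},
      mult = (\<circ>),
      one = id\<rparr>"

definition compact_open_topology :: "('a::topological_space \<Rightarrow> 'b::topological_space) topology" where
  "compact_open_topology =
     topology_generated_by {{f. f ` K \<subseteq> U} |K U. compact K \<and> open U}"

definition isometry_topology :: "('x::metric_space \<Rightarrow> 'x) topology" where
  "isometry_topology = subtopology compact_open_topology (carrier isometry_group)"

text \<open>A uniform lattice \<open>L\<close> of the isometry group of \<open>X\<close> (compactness of \<open>Isom(X)/L\<close>) acts
  cocompactly on \<open>X\<close> only if the isometry group itself does; for the ray \<open>X = [0, \<infinity>)\<close> the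
  isometry group is trivial, and so is its uniform lattice.\<close>

definition cocompact_isometry_group :: "'x::metric_space itself \<Rightarrow> bool" where
  "cocompact_isometry_group _ \<longleftrightarrow>
     (\<exists>K::'x set. compact K \<and> (\<Union>f\<in>carrier isometry_group. f ` K) = UNIV)"

section \<open>Quasi-isometry\<close>

definition quasi_isometric ::
    "'p set \<Rightarrow> ('p \<Rightarrow> 'p \<Rightarrow> real) \<Rightarrow> 'q set \<Rightarrow> ('q \<Rightarrow> 'q \<Rightarrow> real) \<Rightarrow> bool" where
  "quasi_isometric S d S' d' \<longleftrightarrow>
     (\<exists>f c k. f ` S \<subseteq> S' \<and> c \<ge> 1 \<and> k \<ge> 0 \<and>
        (\<forall>x\<in>S. \<forall>y\<in>S. d x y / c - k \<le> d' (f x) (f y) \<and> d' (f x) (f y) \<le> c * d x y + k) \<and>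
        (\<forall>z\<in>S'. \<exists>x\<in>S. d' (f x) z \<le> k))"

definition word_dist :: "('g, 'm) monoid_scheme \<Rightarrow> 'g set \<Rightarrow> 'g \<Rightarrow> 'g \<Rightarrow> real" where
  "word_dist G S x y =
     real (LEAST n. \<exists>xs. length xs = n \<and> set xs \<subseteq> S \<union> (\<lambda>s. inv\<^bsub>G\<^esub> s) ` S \<and>
                        foldr (\<lambda>s t. s \<otimes>\<^bsub>G\<^esub> t) xs \<one>\<^bsub>G\<^esub> = inv\<^bsub>G\<^esub> x \<otimes>\<^bsub>G\<^esub> y)"

definition finite_generating_set :: "('g, 'm) monoid_scheme \<Rightarrow> 'g set \<Rightarrow> bool" where
  "finite_generating_set G S \<longleftrightarrow> finite S \<and> S \<subseteq> carrier G \<and> generate G S = carrier G"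

definition group_quasi_isometric_to ::
    "('g, 'm) monoid_scheme \<Rightarrow> 'q set \<Rightarrow> ('q \<Rightarrow> 'q \<Rightarrow> real) \<Rightarrow> bool" where
  "group_quasi_isometric_to G Y d \<longleftrightarrow>
     (\<exists>S. finite_generating_set G S) \<and>
     (\<forall>S. finite_generating_set G S \<longrightarrow> quasi_isometric (carrier G) (word_dist G S) Y d)"

definition l2_product_dist ::
    "('p \<Rightarrow> 'p \<Rightarrow> real) \<Rightarrow> ('q \<Rightarrow> 'q \<Rightarrow> real) \<Rightarrow> 'p \<times> 'q \<Rightarrow> 'p \<times> 'q \<Rightarrow> real" where
  "l2_product_dist d d' = (\<lambda>(p, q) (p', q'). sqrt ((d p p')\<^sup>2 + (d' q q')\<^sup>2))"

end

theory Submission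
  imports Defs
begin

text \<open>The fundamental group \<open>\<Gamma>\<close> acts on \<open>X\<close> by isometries through the homomorphism \<open>\<psi>\<close> and on the
  Bass--Serre tree by left multiplication of cosets. The diagonal action on \<open>X \<times> T\<close> is proper and
  cobounded, so the Milnor--Schwarz lemma (\<open>geometric_action.milnor_schwarz\<close>) gives the
  quasi-isometry.

  Both properties reduce to one vertex group, the stabiliser of the base vertex of the tree. Its
  image in \<open>Isom(X)\<close> is a uniform lattice and its kernel is finite. A discrete group of isometries
  of a proper space moves a given point by a bounded amount only through finitely many elements
  (\<open>discrete_isometries_proper\<close>), so the vertex group acts properly on \<open>X\<close>; the elements of \<open>\<Gamma>\<close>
  that move the base vertex to a given vertex form a coset of it, and local finiteness of the
  tree bounds the number of vertices to be considered (\<open>product_action_proper\<close>). Conversely a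
  uniform lattice of a cocompact isometry group has coarsely dense orbits in \<open>X\<close>
  (\<open>uniform_lattice_cobounded\<close>). Since the graph \<open>A\<close> is finite, \<open>\<Gamma>\<close> moves the base vertex close to any
  vertex of the tree, and the vertex group then corrects the \<open>X\<close> coordinate without changing
  the tree coordinate (\<open>product_action_cobounded\<close>).

  The product is coarsely geodesic because \<open>X\<close> is geodesic and the Bass--Serre graph is connected:
  a word in the path group lifts to an edge path (\<open>tree_path_of_word\<close>). The argument is carried out
  on \<open>X\<close> times the set of vertices; as every point of the realisation is within distance 1
  of a vertex, passing to the realisation only changes the additive constant.\<close>

section \<open>Words in a group and the Milnor--Schwarz lemma\<close>

context group
begin

lemma word_closed: "set xs \<subseteq> carrier G \<Longrightarrow> foldr (\<otimes>) xs \<one> \<in> carrier G"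
  by (induction xs) auto

lemma word_append:
  assumes "set xs \<subseteq> carrier G" "set ys \<subseteq> carrier G"
  shows "foldr (\<otimes>) (xs @ ys) \<one> = foldr (\<otimes>) xs \<one> \<otimes> foldr (\<otimes>) ys \<one>"
  using assms
proof (induction xs)
  case (Cons x xs)
  then show ?case
    using word_closed[of xs] word_closed[of ys] by (simp add: m_assoc)
qed (simp add: word_closed)

lemma word_in_generate:
  "set xs \<subseteq> F \<Longrightarrow> foldr (\<otimes>) xs \<one> \<in> generate G F"
  by (induction xs) (auto intro: generate.one generate.incl generate.eng)

lemma generate_eq_word:
  assumes "S \<subseteq> carrier G" "x \<in> generate G S"
  shows "\<exists>xs. set xs \<subseteq> S \<union> (\<lambda>s. inv s) ` S \<and> foldr (\<otimes>) xs \<one> = x"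
  using assms(2)
proof (induction rule: generate.induct)
  case one
  then show ?case by (intro exI[of _ "[]"]) simp
next
  case (incl h)
  then show ?case using assms(1) by (intro exI[of _ "[h]"]) auto
next
  case (inv h)
  then show ?case using assms(1) by (intro exI[of _ "[inv h]"]) auto
next
  case (eng h1 h2)
  then obtain xs ys where xs: "set xs \<subseteq> S \<union> (\<lambda>s. inv s) ` S" "foldr (\<otimes>) xs \<one> = h1"
    and ys: "set ys \<subseteq> S \<union> (\<lambda>s. inv s) ` S" "foldr (\<otimes>) ys \<one> = h2" by blast
  have "S \<union> (\<lambda>s. inv s) ` S \<subseteq> carrier G" using assms(1) by auto
  with xs ys have "foldr (\<otimes>) (xs @ ys) \<one> = h1 \<otimes> h2" by (subst word_append) auto
  with xs ys show ?case by (intro exI[of _ "xs @ ys"]) auto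
qed

lemma word_dist_le:
  assumes "set xs \<subseteq> S \<union> (\<lambda>s. inv s) ` S" "foldr (\<otimes>) xs \<one> = inv x \<otimes> y"
  shows "word_dist G S x y \<le> real (length xs)"
  unfolding word_dist_def using assms by (intro of_nat_mono Least_le) auto

lemma word_dist_attained:
  assumes "finite_generating_set G S" "x \<in> carrier G" "y \<in> carrier G"
  obtains xs where "set xs \<subseteq> S \<union> (\<lambda>s. inv s) ` S" "foldr (\<otimes>) xs \<one> = inv x \<otimes> y"
    "word_dist G S x y = real (length xs)"
proof -
  have "inv x \<otimes> y \<in> generate G S" "S \<subseteq> carrier G"
    using assms by (auto simp: finite_generating_set_def)
  then obtain zs where "set zs \<subseteq> S \<union> (\<lambda>s. inv s) ` S" "foldr (\<otimes>) zs \<one> = inv x \<otimes> y"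
    using generate_eq_word by blast
  then have "\<exists>n xs. length xs = n \<and> set xs \<subseteq> S \<union> (\<lambda>s. inv s) ` S \<and>
      foldr (\<lambda>s t. s \<otimes> t) xs \<one> = inv x \<otimes> y" by blast
  from LeastI_ex[OF this] show ?thesis
    using that unfolding word_dist_def by auto
qed

lemma word_substitution:
  assumes S: "S \<subseteq> carrier G" and F: "F \<subseteq> carrier G"
    and M: "\<And>f. f \<in> F \<Longrightarrow> \<exists>ws. set ws \<subseteq> S \<union> (\<lambda>s. inv s) ` S \<and>
      foldr (\<otimes>) ws \<one> = f \<and> length ws \<le> M"
    and "set xs \<subseteq> F"
  shows "\<exists>ws. set ws \<subseteq> S \<union> (\<lambda>s. inv s) ` S \<and> foldr (\<otimes>) ws \<one> = foldr (\<otimes>) xs \<one> \<and>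
    length ws \<le> M * length xs"
  using \<open>set xs \<subseteq> F\<close>
proof (induction xs)
  case (Cons x xs)
  then obtain ws where ws: "set ws \<subseteq> S \<union> (\<lambda>s. inv s) ` S"
      "foldr (\<otimes>) ws \<one> = foldr (\<otimes>) xs \<one>" "length ws \<le> M * length xs" by auto
  obtain vs where vs: "set vs \<subseteq> S \<union> (\<lambda>s. inv s) ` S" "foldr (\<otimes>) vs \<one> = x" "length vs \<le> M"
    using M[of x] Cons.prems by auto
  have "S \<union> (\<lambda>s. inv s) ` S \<subseteq> carrier G" using S by auto
  with ws vs have "foldr (\<otimes>) (vs @ ws) \<one> = x \<otimes> foldr (\<otimes>) xs \<one>" by (subst word_append) auto
  with ws vs show ?case by (intro exI[of _ "vs @ ws"]) auto
qed auto

end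

text \<open>An action of a group on a pseudometric space that has the properties of a geometric action
  as far as they can be seen from the orbit of one point. Being coarsely geodesic is phrased
  with relation powers: two points are joined by a chain of unit steps whose number is bounded
  by an affine function of their distance.\<close>

locale geometric_action = group G for G (structure) +
  fixes Y :: "'p set" and d :: "'p \<Rightarrow> 'p \<Rightarrow> real" and act :: "'a \<Rightarrow> 'p \<Rightarrow> 'p" and o\<^sub>Y :: 'p
  assumes base: "o\<^sub>Y \<in> Y"
    and act_closed: "g \<in> carrier G \<Longrightarrow> y \<in> Y \<Longrightarrow> act g y \<in> Y"
    and act_one: "y \<in> Y \<Longrightarrow> act \<one> y = y"
    and act_mult: "g \<in> carrier G \<Longrightarrow> h \<in> carrier G \<Longrightarrow> y \<in> Y \<Longrightarrow> act (g \<otimes> h) y = act g (act h y)"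
    and act_dist: "g \<in> carrier G \<Longrightarrow> y \<in> Y \<Longrightarrow> z \<in> Y \<Longrightarrow> d (act g y) (act g z) = d y z"
    and d_refl: "y \<in> Y \<Longrightarrow> d y y = 0"
    and d_sym: "y \<in> Y \<Longrightarrow> z \<in> Y \<Longrightarrow> d y z = d z y"
    and d_triangle: "x \<in> Y \<Longrightarrow> y \<in> Y \<Longrightarrow> z \<in> Y \<Longrightarrow> d x z \<le> d x y + d y z"
    and proper: "finite {g \<in> carrier G. d o\<^sub>Y (act g o\<^sub>Y) \<le> r}"
    and cobounded: "\<exists>R. \<forall>y\<in>Y. \<exists>g\<in>carrier G. d (act g o\<^sub>Y) y \<le> R"
    and coarsely_geodesic: "\<exists>c k. \<forall>y\<in>Y. \<forall>z\<in>Y. \<exists>n.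
      (y, z) \<in> {(p, q). p \<in> Y \<and> q \<in> Y \<and> d p q \<le> 1} ^^ n \<and> real n \<le> c * d y z + k"
begin

lemma d_nonneg: "y \<in> Y \<Longrightarrow> z \<in> Y \<Longrightarrow> 0 \<le> d y z"
  using d_triangle[of y z y] d_refl[of y] d_sym[of y z] by simp

lemma orbit_closed: "g \<in> carrier G \<Longrightarrow> act g o\<^sub>Y \<in> Y"
  using act_closed base by blast

lemma dist_orbit:
  assumes "g \<in> carrier G" "h \<in> carrier G"
  shows "d (act g o\<^sub>Y) (act h o\<^sub>Y) = d o\<^sub>Y (act (inv g \<otimes> h) o\<^sub>Y)"
proof -
  have "act h o\<^sub>Y = act (g \<otimes> (inv g \<otimes> h)) o\<^sub>Y"
    using assms by (simp add: m_assoc[symmetric])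
  also have "\<dots> = act g (act (inv g \<otimes> h) o\<^sub>Y)"
    using assms base by (intro act_mult) auto
  finally show ?thesis
    using act_dist[of g o\<^sub>Y "act (inv g \<otimes> h) o\<^sub>Y"] assms base act_closed by simp
qed

text \<open>Replacing each point of a chain of unit steps by a point of the orbit within distance
  \<open>R\<close> writes a group element as a product of elements that move the base point by at most
  \<open>2 * R + 1\<close>.\<close>

lemma word_of_chain:
  assumes "(y, z) \<in> {(p, q). p \<in> Y \<and> q \<in> Y \<and> d p q \<le> 1} ^^ n" "y \<in> Y" "z \<in> Y"
    and "g \<in> carrier G" "h \<in> carrier G" "d (act g o\<^sub>Y) y \<le> R" "d (act h o\<^sub>Y) z \<le> R"
    and R: "\<And>y. y \<in> Y \<Longrightarrow> \<exists>g\<in>carrier G. d (act g o\<^sub>Y) y \<le> R"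
  shows "\<exists>xs. set xs \<subseteq> {g \<in> carrier G. d o\<^sub>Y (act g o\<^sub>Y) \<le> 2 * R + 1} \<and> length xs = Suc n \<and>
    foldr (\<otimes>) xs \<one> = inv g \<otimes> h"
  using assms(1-7)
proof (induction n arbitrary: z h)
  case 0
  have "d o\<^sub>Y (act (inv g \<otimes> h) o\<^sub>Y) \<le> 2 * R + 1"
    using 0 d_triangle[of "act g o\<^sub>Y" y "act h o\<^sub>Y"] d_sym[of y "act h o\<^sub>Y"]
    by (simp add: dist_orbit[symmetric] orbit_closed)
  with 0 show ?case by (intro exI[of _ "[inv g \<otimes> h]"]) auto
next
  case (Suc n)
  then obtain x where x: "(y, x) \<in> {(p, q). p \<in> Y \<and> q \<in> Y \<and> d p q \<le> 1} ^^ n"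
    "x \<in> Y" "d x z \<le> 1" by auto
  obtain f where f: "f \<in> carrier G" "d (act f o\<^sub>Y) x \<le> R" using R x by blast
  obtain xs where xs: "set xs \<subseteq> {g \<in> carrier G. d o\<^sub>Y (act g o\<^sub>Y) \<le> 2 * R + 1}"
      "length xs = Suc n" "foldr (\<otimes>) xs \<one> = inv g \<otimes> f"
    using Suc.IH[OF x(1) _ x(2) _ f(1) _ f(2)] Suc.prems by auto
  have "d (act f o\<^sub>Y) (act h o\<^sub>Y) \<le> d (act f o\<^sub>Y) x + (d x z + d z (act h o\<^sub>Y))"
    using d_triangle[of "act f o\<^sub>Y" x "act h o\<^sub>Y"] d_triangle[of x z "act h o\<^sub>Y"] x f Suc.prems
    by (fastforce simp: orbit_closed)
  then have "d o\<^sub>Y (act (inv f \<otimes> h) o\<^sub>Y) \<le> 2 * R + 1"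
    using x f Suc.prems d_sym[of z "act h o\<^sub>Y"] by (simp add: dist_orbit[symmetric] orbit_closed)
  moreover have "foldr (\<otimes>) (xs @ [inv f \<otimes> h]) \<one> = inv g \<otimes> h"
  proof -
    have "foldr (\<otimes>) (xs @ [inv f \<otimes> h]) \<one> = (inv g \<otimes> f) \<otimes> (inv f \<otimes> h)"
      using xs f Suc.prems by (subst word_append) auto
    also have "\<dots> = inv g \<otimes> h"
      using f Suc.prems by (simp add: m_assoc) (simp add: m_assoc[symmetric])
    finally show ?thesis .
  qed
  ultimately show ?case
    using xs f Suc.prems by (intro exI[of _ "xs @ [inv f \<otimes> h]"]) auto
qed

text \<open>The elements that move the base point by at most \<open>2 * R + 1\<close> are finitely many by properness,
  and the chain that joins two orbit points bounds the number of factors by their distance.\<close>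

lemma orbit_words:
  obtains F c k where "finite F" "F \<subseteq> carrier G"
    "\<And>g h. g \<in> carrier G \<Longrightarrow> h \<in> carrier G \<Longrightarrow> \<exists>xs. set xs \<subseteq> F \<and>
      foldr (\<otimes>) xs \<one> = inv g \<otimes> h \<and> real (length xs) \<le> c * d (act g o\<^sub>Y) (act h o\<^sub>Y) + k"
proof -
  obtain R where R: "\<And>y. y \<in> Y \<Longrightarrow> \<exists>g\<in>carrier G. d (act g o\<^sub>Y) y \<le> R" using cobounded by blast
  have R0: "R \<ge> 0" using R[OF base] d_nonneg[of _ o\<^sub>Y] base orbit_closed by (meson order_trans)
  obtain c k where ck: "\<And>y z. y \<in> Y \<Longrightarrow> z \<in> Y \<Longrightarrow> \<exists>n.
      (y, z) \<in> {(p, q). p \<in> Y \<and> q \<in> Y \<and> d p q \<le> 1} ^^ n \<and> real n \<le> c * d y z + k"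
    using coarsely_geodesic by blast
  show ?thesis
  proof (rule that)
    show "finite {g \<in> carrier G. d o\<^sub>Y (act g o\<^sub>Y) \<le> 2 * R + 1}" by (rule proper)
    show "{g \<in> carrier G. d o\<^sub>Y (act g o\<^sub>Y) \<le> 2 * R + 1} \<subseteq> carrier G" by blast
    fix g h assume gh: "g \<in> carrier G" "h \<in> carrier G"
    obtain n where n: "(act g o\<^sub>Y, act h o\<^sub>Y) \<in> {(p, q). p \<in> Y \<and> q \<in> Y \<and> d p q \<le> 1} ^^ n"
      "real n \<le> c * d (act g o\<^sub>Y) (act h o\<^sub>Y) + k"
      using ck gh orbit_closed by blast
    then obtain xs where "set xs \<subseteq> {g \<in> carrier G. d o\<^sub>Y (act g o\<^sub>Y) \<le> 2 * R + 1}"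
        "length xs = Suc n" "foldr (\<otimes>) xs \<one> = inv g \<otimes> h"
      using word_of_chain[OF n(1) _ _ gh _ _ R] gh R0 orbit_closed d_refl by auto
    with n(2) show "\<exists>xs. set xs \<subseteq> {g \<in> carrier G. d o\<^sub>Y (act g o\<^sub>Y) \<le> 2 * R + 1} \<and>
        foldr (\<otimes>) xs \<one> = inv g \<otimes> h \<and>
        real (length xs) \<le> c * d (act g o\<^sub>Y) (act h o\<^sub>Y) + (k + 1)"
      by (intro exI[of _ xs]) auto
  qed
qed

lemma ex_finite_generating_set: "\<exists>S. finite_generating_set G S"
proof -
  obtain F and c k :: real where F: "finite F" "F \<subseteq> carrier G"
    "\<And>g h. g \<in> carrier G \<Longrightarrow> h \<in> carrier G \<Longrightarrow> \<exists>xs. set xs \<subseteq> F \<and>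
      foldr (\<otimes>) xs \<one> = inv g \<otimes> h \<and> real (length xs) \<le> c * d (act g o\<^sub>Y) (act h o\<^sub>Y) + k"
    by (rule orbit_words, rule that)
  have "h \<in> generate G F" if "h \<in> carrier G" for h
    using F(3)[OF one_closed that] word_in_generate[of _ F] that by force
  then have "generate G F = carrier G" using generate_incl[OF F(2)] by blast
  with F show ?thesis unfolding finite_generating_set_def by blast
qed

lemma orbit_map_upper_bound:
  assumes "finite_generating_set G S"
  obtains L where "L \<ge> 0" "\<And>g h. g \<in> carrier G \<Longrightarrow> h \<in> carrier G \<Longrightarrow>
      d (act g o\<^sub>Y) (act h o\<^sub>Y) \<le> L * word_dist G S g h"
proof -
  let ?S = "S \<union> (\<lambda>s. inv s) ` S"
  have S: "finite ?S" "?S \<subseteq> carrier G" using assms by (auto simp: finite_generating_set_def)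
  define L where "L = Max (insert 0 ((\<lambda>s. d o\<^sub>Y (act s o\<^sub>Y)) ` ?S))"
  have L0: "L \<ge> 0" unfolding L_def using S by (intro Max_ge) auto
  have L: "d o\<^sub>Y (act s o\<^sub>Y) \<le> L" if "s \<in> ?S" for s
    unfolding L_def using S that by (intro Max_ge) auto
  have word: "d o\<^sub>Y (act (foldr (\<otimes>) xs \<one>) o\<^sub>Y) \<le> L * real (length xs)" if "set xs \<subseteq> ?S" for xs
    using that
  proof (induction xs)
    case Nil
    then show ?case using act_one base d_refl by simp
  next
    case (Cons x xs)
    let ?w = "foldr (\<otimes>) xs \<one>"
    have x: "x \<in> carrier G" "?w \<in> carrier G" using Cons.prems S word_closed[of xs] by auto
    have "d o\<^sub>Y (act (x \<otimes> ?w) o\<^sub>Y) \<le> d o\<^sub>Y (act x o\<^sub>Y) + d (act x o\<^sub>Y) (act (x \<otimes> ?w) o\<^sub>Y)"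
      using x base orbit_closed by (intro d_triangle) auto
    also have "d (act x o\<^sub>Y) (act (x \<otimes> ?w) o\<^sub>Y) = d o\<^sub>Y (act ?w o\<^sub>Y)"
      using x by (simp add: dist_orbit m_assoc[symmetric])
    finally show ?case using L[of x] Cons by (simp add: algebra_simps)
  qed
  show ?thesis
  proof (rule that[OF L0])
    fix g h assume gh: "g \<in> carrier G" "h \<in> carrier G"
    then obtain xs where "set xs \<subseteq> ?S" "foldr (\<otimes>) xs \<one> = inv g \<otimes> h"
      "word_dist G S g h = real (length xs)" using word_dist_attained[OF assms] by blast
    with word[of xs] gh show "d (act g o\<^sub>Y) (act h o\<^sub>Y) \<le> L * word_dist G S g h"
      by (simp add: dist_orbit)
  qed
qed

text \<open>Two orbit points at distance \<open>D\<close> differ by a product of \<open>O(D)\<close> elements of a fixed finite set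
  (\<open>orbit_words\<close>); spelling each of them out in the generating set \<open>S\<close> multiplies the length by at
  most a constant.\<close>

lemma orbit_map_lower_bound:
  assumes "finite_generating_set G S"
  obtains p q where "p \<ge> 1" "q \<ge> 0" "\<And>g h. g \<in> carrier G \<Longrightarrow> h \<in> carrier G \<Longrightarrow>
      word_dist G S g h \<le> p * d (act g o\<^sub>Y) (act h o\<^sub>Y) + q"
proof -
  have S: "S \<subseteq> carrier G" "generate G S = carrier G"
    using assms by (auto simp: finite_generating_set_def)
  obtain F and c k :: real where F: "finite F" "F \<subseteq> carrier G"
    "\<And>g h. g \<in> carrier G \<Longrightarrow> h \<in> carrier G \<Longrightarrow> \<exists>xs. set xs \<subseteq> F \<and>
      foldr (\<otimes>) xs \<one> = inv g \<otimes> h \<and> real (length xs) \<le> c * d (act g o\<^sub>Y) (act h o\<^sub>Y) + k"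
    by (rule orbit_words, rule that)
  have "\<forall>f\<in>F. \<exists>ws. set ws \<subseteq> S \<union> (\<lambda>s. inv s) ` S \<and> foldr (\<otimes>) ws \<one> = f"
    using generate_eq_word[OF S(1)] S F(2) by blast
  then obtain W where W: "\<And>f. f \<in> F \<Longrightarrow> set (W f) \<subseteq> S \<union> (\<lambda>s. inv s) ` S \<and>
      foldr (\<otimes>) (W f) \<one> = f" by metis
  define M where "M = Max (insert 0 ((\<lambda>f. length (W f)) ` F))"
  have M: "length (W f) \<le> M" if "f \<in> F" for f
    unfolding M_def using F that by (intro Max_ge) auto
  show ?thesis
  proof (rule that)
    show "real M * \<bar>c\<bar> + 1 \<ge> 1" "real M * \<bar>k\<bar> \<ge> 0" by simp_all
    fix g h assume gh: "g \<in> carrier G" "h \<in> carrier G"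
    let ?D = "d (act g o\<^sub>Y) (act h o\<^sub>Y)"
    have D: "?D \<ge> 0" using gh orbit_closed d_nonneg by blast
    obtain xs where xs: "set xs \<subseteq> F" "foldr (\<otimes>) xs \<one> = inv g \<otimes> h"
        "real (length xs) \<le> c * ?D + k" using F(3)[OF gh] by blast
    obtain ws where ws: "set ws \<subseteq> S \<union> (\<lambda>s. inv s) ` S"
        "foldr (\<otimes>) ws \<one> = foldr (\<otimes>) xs \<one>" "length ws \<le> M * length xs"
      using word_substitution[OF S(1) F(2) _ xs(1), of M] W M by blast
    have "word_dist G S g h \<le> real (length ws)" using word_dist_le ws xs by simp
    also have "\<dots> \<le> real M * real (length xs)"
      using ws(3) by (metis of_nat_le_iff of_nat_mult)
    also have "\<dots> \<le> real M * (\<bar>c\<bar> * ?D + \<bar>k\<bar>)"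
    proof (rule mult_left_mono)
      have "c * ?D \<le> \<bar>c\<bar> * ?D" using D by (intro mult_right_mono) auto
      then show "real (length xs) \<le> \<bar>c\<bar> * ?D + \<bar>k\<bar>" using xs(3) by linarith
    qed simp
    also have "\<dots> \<le> (real M * \<bar>c\<bar> + 1) * ?D + real M * \<bar>k\<bar>"
      using D by (simp add: algebra_simps)
    finally show "word_dist G S g h \<le> (real M * \<bar>c\<bar> + 1) * ?D + real M * \<bar>k\<bar>" .
  qed
qed

text \<open>The orbit map of the base point is a quasi-isometry: the two bounds on distances are the lemmas
  above, and it is coarsely surjective because the action is cobounded.\<close>

theorem milnor_schwarz: "group_quasi_isometric_to G Y d"
  unfolding group_quasi_isometric_to_def
proof (intro conjI allI impI)
  show "\<exists>S. finite_generating_set G S" by (rule ex_finite_generating_set)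
  fix S assume S: "finite_generating_set G S"
  obtain L where L: "L \<ge> 0" "\<And>g h. g \<in> carrier G \<Longrightarrow> h \<in> carrier G \<Longrightarrow>
      d (act g o\<^sub>Y) (act h o\<^sub>Y) \<le> L * word_dist G S g h" using orbit_map_upper_bound[OF S] by blast
  obtain p q where pq: "p \<ge> 1" "q \<ge> 0" "\<And>g h. g \<in> carrier G \<Longrightarrow> h \<in> carrier G \<Longrightarrow>
      word_dist G S g h \<le> p * d (act g o\<^sub>Y) (act h o\<^sub>Y) + q" using orbit_map_lower_bound[OF S] by blast
  obtain R where R: "\<And>y. y \<in> Y \<Longrightarrow> \<exists>g\<in>carrier G. d (act g o\<^sub>Y) y \<le> R" using cobounded by blast
  define c k where "c = max p L" and "k = max q R"
  have c: "c \<ge> 1" "c \<ge> p" "c \<ge> L" and k: "k \<ge> 0" "k \<ge> q" "k \<ge> R"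
    using pq unfolding c_def k_def by auto
  show "quasi_isometric (carrier G) (word_dist G S) Y d"
    unfolding quasi_isometric_def
  proof (rule exI[of _ "\<lambda>g. act g o\<^sub>Y"], rule exI[of _ c], rule exI[of _ k], intro conjI ballI)
    show "(\<lambda>g. act g o\<^sub>Y) ` carrier G \<subseteq> Y" using orbit_closed by blast
    show "c \<ge> 1" "k \<ge> 0" using c k by auto
    fix g h assume gh: "g \<in> carrier G" "h \<in> carrier G"
    let ?D = "d (act g o\<^sub>Y) (act h o\<^sub>Y)" and ?w = "word_dist G S g h"
    have D: "?D \<ge> 0" using gh orbit_closed d_nonneg by blast
    have w: "?w \<ge> 0" by (simp add: word_dist_def)
    have "?w \<le> p * ?D + q" using pq gh by blast
    also have "\<dots> \<le> c * ?D + c * k"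
      using c k D pq mult_right_mono[of p c ?D] mult_right_mono[of 1 c k] by linarith
    finally show "?w / c - k \<le> ?D" using c by (simp add: field_simps)
    have "?D \<le> c * ?w" using L(2)[OF gh] mult_right_mono[OF c(3) w] by linarith
    then show "?D \<le> c * ?w + k" using k by linarith
  next
    fix z assume "z \<in> Y"
    then show "\<exists>x\<in>carrier G. d (act x o\<^sub>Y) z \<le> k" using R k by (meson order_trans)
  qed
qed

end

text \<open>Enlarging the target by points at bounded distance from it keeps the quasi-isometry class. That
  \<open>z\<close> is close to \<open>y\<close> is expressed by comparing the distances from all other points, because
  \<open>d'\<close> is known on the image of \<open>Y\<close> only.\<close>

lemma group_quasi_isometric_to_thickening:
  assumes "group_quasi_isometric_to G Y d"
    and f: "f ` Y \<subseteq> Z" "\<And>y y'. y \<in> Y \<Longrightarrow> y' \<in> Y \<Longrightarrow> d' (f y) (f y') = d y y'"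
    and near: "\<And>z. z \<in> Z \<Longrightarrow> \<exists>y\<in>Y. \<forall>x\<in>Y. d' (f x) z \<le> d x y + r"
  shows "group_quasi_isometric_to G Z d'"
  unfolding group_quasi_isometric_to_def
proof (intro conjI allI impI)
  show "\<exists>S. finite_generating_set G S"
    using assms(1) by (simp add: group_quasi_isometric_to_def)
  fix S assume "finite_generating_set G S"
  then have "quasi_isometric (carrier G) (word_dist G S) Y d"
    using assms(1) by (simp add: group_quasi_isometric_to_def)
  then obtain q c k where q: "q ` carrier G \<subseteq> Y" "c \<ge> 1" "k \<ge> 0"
    "\<And>x y. x \<in> carrier G \<Longrightarrow> y \<in> carrier G \<Longrightarrow>
      word_dist G S x y / c - k \<le> d (q x) (q y) \<and> d (q x) (q y) \<le> c * word_dist G S x y + k"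
    "\<And>z. z \<in> Y \<Longrightarrow> \<exists>x\<in>carrier G. d (q x) z \<le> k"
    unfolding quasi_isometric_def by auto
  show "quasi_isometric (carrier G) (word_dist G S) Z d'"
    unfolding quasi_isometric_def
  proof (rule exI[of _ "f \<circ> q"], rule exI[of _ c], rule exI[of _ "k + \<bar>r\<bar>"], intro conjI ballI)
    show "(f \<circ> q) ` carrier G \<subseteq> Z" "c \<ge> 1" "k + \<bar>r\<bar> \<ge> 0" using q(1-3) f(1) by (auto simp: image_subset_iff)
    fix x y assume xy: "x \<in> carrier G" "y \<in> carrier G"
    then have eq: "d' ((f \<circ> q) x) ((f \<circ> q) y) = d (q x) (q y)"
      using q(1) f(2)[of "q x" "q y"] by (simp add: image_subset_iff)
    show "word_dist G S x y / c - (k + \<bar>r\<bar>) \<le> d' ((f \<circ> q) x) ((f \<circ> q) y)"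
      "d' ((f \<circ> q) x) ((f \<circ> q) y) \<le> c * word_dist G S x y + (k + \<bar>r\<bar>)"
      unfolding eq using q(4)[OF xy] by linarith+
  next
    fix z assume "z \<in> Z"
    then obtain y where y: "y \<in> Y" "\<forall>x\<in>Y. d' (f x) z \<le> d x y + r" using near by blast
    obtain x where "x \<in> carrier G" "d (q x) y \<le> k" using q(5) y by blast
    with y q(1) show "\<exists>x\<in>carrier G. d' ((f \<circ> q) x) z \<le> k + \<bar>r\<bar>"
      by (intro bexI[of _ x]) (fastforce simp: image_subset_iff)+
  qed
qed

section \<open>The path metric of a connected graph\<close>

lemma edge_path_append:
  "serre_graph A \<Longrightarrow> edge_path A a es b \<Longrightarrow> edge_path A b fs c \<Longrightarrow> edge_path A a (es @ fs) c"
  by (induction es arbitrary: a) auto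

lemma edge_path_rev:
  assumes "serre_graph A"
  shows "edge_path A a es b \<Longrightarrow> edge_path A b (rev (map (bar A) es)) a"
proof (induction es arbitrary: a)
  case (Cons e es)
  then have "edge_path A b (rev (map (bar A) es)) (ter A e)" by simp
  moreover have "edge_path A (ter A e) [bar A e] a"
    using Cons.prems assms by (auto simp: serre_graph_def)
  ultimately show ?case using edge_path_append[OF assms] by fastforce
qed simp

lemma graph_dist_le: "edge_path A a es b \<Longrightarrow> graph_dist A a b \<le> real (length es)"
  unfolding graph_dist_def by (intro of_nat_mono Least_le) blast

lemma graph_dist_attained:
  assumes "connected_graph A" "a \<in> verts A" "b \<in> verts A"
  shows "\<exists>es. edge_path A a es b \<and> graph_dist A a b = real (length es)"
proof -
  obtain es where "edge_path A a es b" using assms unfolding connected_graph_def by blast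
  then have "\<exists>n es. edge_path A a es b \<and> length es = n" by blast
  from LeastI_ex[OF this] show ?thesis unfolding graph_dist_def by auto
qed

lemma graph_dist_nonneg: "0 \<le> graph_dist A a b"
  by (simp add: graph_dist_def)

lemma graph_dist_self: "a \<in> verts A \<Longrightarrow> graph_dist A a a = 0"
  using graph_dist_le[of A a "[]" a] graph_dist_nonneg[of A a a] by simp

lemma graph_dist_triangle:
  assumes "serre_graph A" "connected_graph A" "a \<in> verts A" "b \<in> verts A" "c \<in> verts A"
  shows "graph_dist A a c \<le> graph_dist A a b + graph_dist A b c"
proof -
  obtain es where "edge_path A a es b" "graph_dist A a b = real (length es)"
    using graph_dist_attained[OF assms(2-4)] by blast
  moreover obtain fs where "edge_path A b fs c" "graph_dist A b c = real (length fs)"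
    using graph_dist_attained[OF assms(2,4,5)] by blast
  ultimately show ?thesis using graph_dist_le[OF edge_path_append[OF assms(1)], of a es b fs c] by simp
qed

lemma graph_dist_sym:
  assumes "serre_graph A" "connected_graph A" "a \<in> verts A" "b \<in> verts A"
  shows "graph_dist A a b = graph_dist A b a"
proof -
  have "graph_dist A b a \<le> graph_dist A a b" if ab: "a \<in> verts A" "b \<in> verts A" for a b
  proof -
    obtain es where "edge_path A a es b" "graph_dist A a b = real (length es)"
      using graph_dist_attained[OF assms(2) ab] by blast
    then show ?thesis using graph_dist_le[OF edge_path_rev[OF assms(1)], of a es b] by simp
  qed
  then show ?thesis using assms by (simp add: antisym)
qed

lemma graph_dist_chain:
  assumes "serre_graph A" "edge_path A a es b"
  shows "(a, b) \<in> {(p, q). p \<in> verts A \<and> q \<in> verts A \<and> graph_dist A p q \<le> 1} ^^ length es"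
  using assms(2)
proof (induction es arbitrary: a)
  case (Cons e es)
  have "ini A e \<in> verts A" "ter A e \<in> verts A"
    using Cons.prems assms(1) by (auto simp: serre_graph_def)
  moreover have "graph_dist A a (ter A e) \<le> 1"
    using graph_dist_le[of A a "[e]" "ter A e"] Cons.prems calculation by auto
  ultimately have "(a, ter A e) \<in> {(p, q). p \<in> verts A \<and> q \<in> verts A \<and> graph_dist A p q \<le> 1}"
    using Cons.prems by simp
  moreover have "(ter A e, b) \<in>
      {(p, q). p \<in> verts A \<and> q \<in> verts A \<and> graph_dist A p q \<le> 1} ^^ length es"
    using Cons by simp
  ultimately have "(a, b) \<in>
      {(p, q). p \<in> verts A \<and> q \<in> verts A \<and> graph_dist A p q \<le> 1} ^^ Suc (length es)"
    by (rule relpow_Suc_I2)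
  then show ?case by (simp only: length_Cons)
qed simp

lemma finite_sphere:
  assumes "serre_graph A" "locally_finite_graph A"
  shows "v \<in> verts A \<Longrightarrow> finite {w. \<exists>es. edge_path A v es w \<and> length es = n}"
proof (induction n arbitrary: v)
  case 0
  have "{w. \<exists>es. edge_path A v es w \<and> length es = 0} \<subseteq> {v}" by auto
  then show ?case by (rule finite_subset) simp
next
  case (Suc n)
  have "{w. \<exists>es. edge_path A v es w \<and> length es = Suc n} \<subseteq>
    (\<Union>e\<in>{e \<in> edges A. ini A e = v}. {w. \<exists>es. edge_path A (ter A e) es w \<and> length es = n})"
  proof
    fix w assume "w \<in> {w. \<exists>es. edge_path A v es w \<and> length es = Suc n}"
    then obtain e es where "edge_path A v (e # es) w" "length es = n" by (auto simp: length_Suc_conv)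
    then show "w \<in> (\<Union>e\<in>{e \<in> edges A. ini A e = v}.
        {w. \<exists>es. edge_path A (ter A e) es w \<and> length es = n})" by auto
  qed
  moreover have "finite \<dots>"
    using Suc assms by (auto simp: locally_finite_graph_def serre_graph_def)
  ultimately show ?case by (rule finite_subset)
qed

lemma finite_graph_ball:
  assumes "serre_graph A" "connected_graph A" "locally_finite_graph A" "v \<in> verts A"
  shows "finite {w \<in> verts A. graph_dist A v w \<le> r}"
proof (rule finite_subset)
  show "{w \<in> verts A. graph_dist A v w \<le> r} \<subseteq>
    (\<Union>n\<le>nat \<lceil>r\<rceil>. {w. \<exists>es. edge_path A v es w \<and> length es = n})"
  proof
    fix w assume w: "w \<in> {w \<in> verts A. graph_dist A v w \<le> r}"
    then obtain es where es: "edge_path A v es w" "graph_dist A v w = real (length es)"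
      using graph_dist_attained[OF assms(2,4)] by blast
    have "length es \<le> nat \<lceil>r\<rceil>" using w es(2) by (simp add: le_nat_iff) linarith
    with es show "w \<in> (\<Union>n\<le>nat \<lceil>r\<rceil>. {w. \<exists>es. edge_path A v es w \<and> length es = n})" by blast
  qed
  show "finite (\<Union>n\<le>nat \<lceil>r\<rceil>. {w. \<exists>es. edge_path A v es w \<and> length es = n})"
    by (intro finite_UN_I finite_atMost finite_sphere assms)
qed

section \<open>Lattices in the isometry group of a proper space\<close>

lemma isometry_groupD:
  assumes "f \<in> carrier isometry_group"
  shows "bij f" "dist (f x) (f y) = dist x y"
  using assms by (auto simp: isometry_group_def)

lemma isometry_group_mult [simp]: "f \<otimes>\<^bsub>isometry_group\<^esub> g = f \<circ> g"
  by (simp add: isometry_group_def)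

lemma isometry_group_one [simp]: "\<one>\<^bsub>isometry_group\<^esub> = id"
  by (simp add: isometry_group_def)

lemma group_isometry_group: "group (isometry_group :: ('x::metric_space \<Rightarrow> 'x) monoid)"
proof (rule groupI)
  fix f :: "'x \<Rightarrow> 'x" assume "f \<in> carrier isometry_group"
  then have f: "bij f" "\<And>x y. dist (f x) (f y) = dist x y" by (auto simp: isometry_group_def)
  have "dist (inv_into UNIV f x) (inv_into UNIV f y) = dist x y" for x y
    using f(2)[of "inv_into UNIV f x" "inv_into UNIV f y"] f(1) by (simp add: bij_is_surj surj_f_inv_f)
  then have "inv_into UNIV f \<in> carrier isometry_group"
    using f(1) by (simp add: isometry_group_def bij_imp_bij_inv)
  moreover have "inv_into UNIV f \<otimes>\<^bsub>isometry_group\<^esub> f = \<one>\<^bsub>isometry_group\<^esub>"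
    using f(1) by (simp add: bij_is_inj)
  ultimately show "\<exists>g\<in>carrier isometry_group. g \<otimes>\<^bsub>isometry_group\<^esub> f = \<one>\<^bsub>isometry_group\<^esub>" by blast
qed (auto simp: isometry_group_def bij_comp)

lemma isometry_inv_apply:
  assumes "f \<in> carrier (isometry_group :: ('x::metric_space \<Rightarrow> 'x) monoid)"
  shows "(inv\<^bsub>isometry_group\<^esub> f) (f x) = x" "f ((inv\<^bsub>isometry_group\<^esub> f) x) = x"
  using group.l_inv[OF group_isometry_group assms] group.r_inv[OF group_isometry_group assms]
  by (auto simp: fun_eq_iff)

text \<open>A compact subset of an open set has a uniform neighbourhood in it, so a subbasic neighbourhood
  of the identity contains all maps that are close enough to the identity on a compact set.\<close>

lemma compact_open_nbhd_id:
  fixes V :: "('x::metric_space \<Rightarrow> 'x) set"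
  assumes "openin compact_open_topology V" "id \<in> V"
  shows "\<exists>K \<epsilon>. compact K \<and> \<epsilon> > 0 \<and> {f. \<forall>x\<in>K. dist (f x) x < \<epsilon>} \<subseteq> V"
proof -
  have "generate_topology_on {{f. f ` K \<subseteq> U} |(K::'x set) (U::'x set). compact K \<and> open U} V"
    using assms(1) by (simp add: compact_open_topology_def openin_topology_generated_by_iff)
  then show ?thesis using assms(2)
  proof (induction rule: generate_topology_on.induct)
    case Empty
    then show ?case by simp
  next
    case (Int V W)
    then obtain K \<epsilon> K' \<epsilon>' where
      "compact K" "\<epsilon> > 0" "{f. \<forall>x\<in>K. dist (f x) x < \<epsilon>} \<subseteq> V"
      "compact K'" "\<epsilon>' > 0" "{f. \<forall>x\<in>K'. dist (f x) x < \<epsilon>'} \<subseteq> W" by auto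
    then show ?case
      by (intro exI[of _ "K \<union> K'"] exI[of _ "min \<epsilon> \<epsilon>'"]) auto
  next
    case (UN \<V>)
    then obtain V where "V \<in> \<V>" "id \<in> V" by blast
    with UN.IH[of V] show ?case by (meson Sup_upper order_trans)
  next
    case (Basis V)
    then obtain K U :: "'x set" where KU: "V = {f. f ` K \<subseteq> U}" "compact K" "open U" "K \<subseteq> U" by auto
    obtain \<epsilon> where "\<epsilon> > 0" "(\<Union>x\<in>K. ball x \<epsilon>) \<subseteq> U"
      using compact_subset_open_imp_ball_epsilon_subset[OF KU(2-4)] by blast
    moreover have "f ` K \<subseteq> (\<Union>x\<in>K. ball x \<epsilon>)" if "\<forall>x\<in>K. dist (f x) x < \<epsilon>" for f
      using that by (fastforce simp: dist_commute)
    ultimately have "{f. \<forall>x\<in>K. dist (f x) x < \<epsilon>} \<subseteq> V" unfolding KU(1) by blast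
    with KU(2) \<open>\<epsilon> > 0\<close> show ?case by blast
  qed
qed

lemma finite_net:
  fixes K :: "'x::metric_space set"
  assumes "compact K" "\<epsilon> > 0"
  shows "\<exists>N. finite N \<and> K \<subseteq> (\<Union>x\<in>N. ball x \<epsilon>)"
  using assms unfolding compact_eq_totally_bounded by blast

text \<open>A pigeonhole form of the Arzela--Ascoli argument: were there infinitely many elements of \<open>L\<close> that
  move \<open>x\<^sub>0\<close> by at most \<open>r\<close>, two of them would agree up to \<open>\<epsilon>\<close> on a given compact set, and their quotient would be a
  nontrivial element of \<open>L\<close> in a given neighbourhood of the identity.\<close>

lemma discrete_isometries_proper:
  fixes x\<^sub>0 :: "'x::heine_borel"
  assumes L: "subgroup L isometry_group" "discrete_in isometry_topology L"
  shows "finite {h \<in> L. dist (h x\<^sub>0) x\<^sub>0 \<le> r}"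
proof -
  interpret I: group "isometry_group :: ('x \<Rightarrow> 'x) monoid" by (rule group_isometry_group)
  have idL: "id \<in> L" using subgroup.one_closed[OF L(1)] by simp
  have LI: "L \<subseteq> carrier isometry_group" using L(1) by (rule subgroup.subset)
  have "openin (subtopology isometry_topology L) {id}"
    using L(2) idL by (simp add: discrete_in_def)
  then obtain W where W: "openin isometry_topology W" "{id} = W \<inter> L"
    unfolding openin_subtopology by blast
  then obtain V where V: "openin compact_open_topology V" "W = V \<inter> carrier isometry_group"
    unfolding isometry_topology_def openin_subtopology by blast
  have "id \<in> V" using V(2) W(2) by blast
  then obtain K \<epsilon> where K: "compact K" "\<epsilon> > 0" "{f. \<forall>x\<in>K. dist (f x) x < \<epsilon>} \<subseteq> V"
    using compact_open_nbhd_id[OF V(1)] by blast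
  have \<epsilon>4: "\<epsilon> / 4 > 0" using K(2) by simp
  have trivial: "h = id" if "h \<in> L" "\<forall>x\<in>K. dist (h x) x < \<epsilon>" for h
  proof -
    have "h \<in> W \<inter> L" using that K(3) V(2) LI by blast
    then show ?thesis using W(2) by blast
  qed
  obtain N where N: "finite N" "K \<subseteq> (\<Union>x\<in>N. ball x (\<epsilon> / 4))"
    using finite_net[OF K(1) \<epsilon>4] by blast
  have "\<exists>M. finite M \<and> cball x\<^sub>0 (r + dist x x\<^sub>0) \<subseteq> (\<Union>y\<in>M. ball y (\<epsilon> / 4))" for x
    by (rule finite_net[OF compact_cball \<epsilon>4])
  then obtain M where M: "\<And>x. finite (M x)"
      "\<And>x. cball x\<^sub>0 (r + dist x x\<^sub>0) \<subseteq> (\<Union>y\<in>M x. ball y (\<epsilon> / 4))" by metis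
  \<comment> \<open>\<open>\<Phi> h\<close> records, up to an error below \<open>\<epsilon> / 4\<close>, where \<open>h\<close> sends the points of the net \<open>N\<close> of
    \<open>K\<close>. It takes finitely many values as long as \<open>h\<close> moves \<open>x\<^sub>0\<close> by at most \<open>r\<close>, and \<open>\<Phi> g = \<Phi> h\<close> gives \<open>dist (g x) (h x) < \<epsilon>\<close> on \<open>K\<close> by
    four steps of length less than \<open>\<epsilon> / 4\<close>.\<close>
  define \<Phi> where "\<Phi> h = restrict (\<lambda>x. SOME y. y \<in> M x \<and> dist y (h x) < \<epsilon> / 4) N" for h :: "'x \<Rightarrow> 'x"
  let ?F = "{h \<in> L. dist (h x\<^sub>0) x\<^sub>0 \<le> r}"
  have \<Phi>: "\<Phi> h x \<in> M x \<and> dist (\<Phi> h x) (h x) < \<epsilon> / 4" if "h \<in> ?F" "x \<in> N" for h x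
  proof -
    have "dist x\<^sub>0 (h x) \<le> dist (h x\<^sub>0) x\<^sub>0 + dist (h x\<^sub>0) (h x)"
      using dist_triangle[of x\<^sub>0 "h x" "h x\<^sub>0"] by (simp add: dist_commute)
    also have "dist (h x\<^sub>0) (h x) = dist x x\<^sub>0"
      using isometry_groupD(2)[of h] that LI by (auto simp: dist_commute)
    finally have "h x \<in> cball x\<^sub>0 (r + dist x x\<^sub>0)" using that by auto
    then have "h x \<in> (\<Union>y\<in>M x. ball y (\<epsilon> / 4))" using M(2) by blast
    then have "\<exists>y. y \<in> M x \<and> dist y (h x) < \<epsilon> / 4" by auto
    from someI_ex[OF this] show ?thesis using that by (simp add: \<Phi>_def)
  qed
  have "inj_on \<Phi> ?F"
  proof (rule inj_onI)
    fix g h assume gh: "g \<in> ?F" "h \<in> ?F" "\<Phi> g = \<Phi> h"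
    then have I: "g \<in> carrier isometry_group" "h \<in> carrier isometry_group" using LI by auto
    have "(inv\<^bsub>isometry_group\<^esub> g \<otimes>\<^bsub>isometry_group\<^esub> h) = id"
    proof (rule trivial)
      show "inv\<^bsub>isometry_group\<^esub> g \<otimes>\<^bsub>isometry_group\<^esub> h \<in> L"
        using gh L(1) by (intro subgroup.m_closed subgroup.m_inv_closed) auto
      show "\<forall>x\<in>K. dist ((inv\<^bsub>isometry_group\<^esub> g \<otimes>\<^bsub>isometry_group\<^esub> h) x) x < \<epsilon>"
      proof
        fix x assume "x \<in> K"
        then obtain y where y: "y \<in> N" "dist y x < \<epsilon> / 4" using N by auto
        have "dist ((inv\<^bsub>isometry_group\<^esub> g \<otimes>\<^bsub>isometry_group\<^esub> h) x) x = dist (h x) (g x)"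
          using isometry_groupD(2)[OF I(1), of "(inv\<^bsub>isometry_group\<^esub> g) (h x)" x] I
          by (simp add: isometry_inv_apply)
        also have "\<dots> \<le> dist (h x) (h y) + (dist (h y) (\<Phi> h y) + (dist (\<Phi> g y) (g y) + dist (g y) (g x)))"
          using dist_triangle[of "h x" "g x" "h y"] dist_triangle[of "h y" "g x" "\<Phi> h y"]
            dist_triangle[of "\<Phi> h y" "g x" "g y"] gh(3) by simp
        also have "\<dots> < \<epsilon>"
          using \<Phi>[OF gh(1) y(1)] \<Phi>[OF gh(2) y(1)] y(2) isometry_groupD(2)[OF I(1), of y x]
            isometry_groupD(2)[OF I(2), of x y] dist_commute[of x y] dist_commute[of "h y" "\<Phi> h y"]
          by linarith
        finally show "dist ((inv\<^bsub>isometry_group\<^esub> g \<otimes>\<^bsub>isometry_group\<^esub> h) x) x < \<epsilon>" .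
      qed
    qed
    then have "(inv\<^bsub>isometry_group\<^esub> g) (h x) = x" for x by (simp add: fun_eq_iff)
    then have "h x = g x" for x using isometry_inv_apply(2)[OF I(1), of "h x"] by simp
    then show "g = h" by auto
  qed
  moreover have "\<Phi> h \<in> PiE N M" if "h \<in> ?F" for h
  proof (rule PiE_I)
    show "\<Phi> h x \<in> M x" if "x \<in> N" for x using \<Phi> \<open>h \<in> ?F\<close> that by blast
    show "\<Phi> h x = undefined" if "x \<notin> N" for x using that by (simp add: \<Phi>_def)
  qed
  then have "\<Phi> ` ?F \<subseteq> PiE N M" by (rule image_subsetI)
  then have "finite (\<Phi> ` ?F)" using finite_PiE[OF N(1) M(1)] by (rule finite_subset)
  ultimately show ?thesis by (rule finite_imageD[rotated])
qed

lemma openin_isometries_moving_less: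
  fixes x\<^sub>0 y :: "'x::metric_space"
  shows "openin isometry_topology {g \<in> carrier isometry_group. dist (g y) x\<^sub>0 < n}"
proof -
  have "openin compact_open_topology {g. g ` {y} \<subseteq> ball x\<^sub>0 n}"
    unfolding compact_open_topology_def
    by (intro topology_generated_by_Basis CollectI exI[of _ "{y}"] exI[of _ "ball x\<^sub>0 n"]) simp
  moreover have "{g \<in> carrier isometry_group. dist (g y) x\<^sub>0 < n} =
      {g. g ` {y} \<subseteq> ball x\<^sub>0 n} \<inter> carrier isometry_group"
    by (auto simp: dist_commute)
  ultimately show ?thesis unfolding isometry_topology_def by (auto simp: openin_subtopology)
qed

text \<open>Cosets \<open>g L\<close> that contain an element moving the base point by less than \<open>n\<close> form an open
  exhaustion \<open>W n\<close> of the quotient, so by compactness a single \<open>n\<close> suffices for all cosets. For an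
  isometry \<open>f\<close>, applying this to the coset of its inverse yields \<open>l \<in> L\<close> with \<open>l x\<^sub>0\<close> within \<open>n\<close>
  of \<open>f x\<^sub>0\<close>; and the orbit of \<open>x\<^sub>0\<close> under all isometries is coarsely dense.\<close>

lemma uniform_lattice_cobounded:
  fixes x\<^sub>0 :: "'x::metric_space"
  assumes "uniform_lattice_in isometry_group isometry_topology L"
    and "cocompact_isometry_group TYPE('x)"
  obtains R where "\<And>x::'x. \<exists>h\<in>L. dist (h x\<^sub>0) x \<le> R"
proof -
  interpret I: group "isometry_group :: ('x \<Rightarrow> 'x) monoid" by (rule group_isometry_group)
  let ?q = "\<lambda>g. g <#\<^bsub>isometry_group\<^esub> L" and ?I = "carrier (isometry_group :: ('x \<Rightarrow> 'x) monoid)"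
  have L: "subgroup L isometry_group" and
    comp: "compact_space (quotient_topology isometry_topology ?q)"
    using assms(1) by (auto simp: uniform_lattice_in_def lattice_in_def)
  have LI: "L \<subseteq> ?I" using L by (rule subgroup.subset)
  have top: "topspace (isometry_topology :: ('x \<Rightarrow> 'x) topology) = ?I"
  proof -
    have "UNIV = {f::'x \<Rightarrow> 'x. f ` {} \<subseteq> UNIV}" by simp
    then have "openin compact_open_topology (UNIV :: ('x \<Rightarrow> 'x) set)"
      unfolding compact_open_topology_def
      by (intro topology_generated_by_Basis CollectI exI[of _ "{}"] exI[of _ UNIV]) simp
    then show ?thesis unfolding isometry_topology_def
      using openin_subset[of compact_open_topology "UNIV :: ('x \<Rightarrow> 'x) set"] by auto
  qed
  define W where "W n = ?q ` {g \<in> ?I. \<exists>l\<in>L. dist ((g \<circ> l) x\<^sub>0) x\<^sub>0 < real n}" for n :: nat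
  have W: "g \<in> ?I \<Longrightarrow> ?q g \<in> W n \<longleftrightarrow> (\<exists>l\<in>L. dist ((g \<circ> l) x\<^sub>0) x\<^sub>0 < real n)" for g n
  proof
    assume g: "g \<in> ?I" and "?q g \<in> W n"
    then obtain g' l where g': "g' \<in> ?I" "l \<in> L" "dist ((g' \<circ> l) x\<^sub>0) x\<^sub>0 < real n" "?q g = ?q g'"
      unfolding W_def by auto
    then have "g' \<circ> l \<in> ?q g'" by (force simp: l_coset_def)
    then have "\<exists>l'\<in>L. g' \<circ> l = g \<circ> l'" unfolding g'(4)[symmetric] by (auto simp: l_coset_def)
    then show "\<exists>l\<in>L. dist ((g \<circ> l) x\<^sub>0) x\<^sub>0 < real n" using g'(3) by metis
  qed (auto simp: W_def)
  have openW: "openin (quotient_topology isometry_topology ?q) (W n)" for n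
  proof -
    have "{g \<in> ?I. ?q g \<in> W n} = (\<Union>l\<in>L. {g \<in> ?I. dist (g (l x\<^sub>0)) x\<^sub>0 < real n})"
      using W by auto
    moreover have "openin isometry_topology \<dots>"
      using openin_isometries_moving_less by blast
    ultimately show ?thesis
      unfolding openin_quotient_topology top using W_def by auto
  qed
  have mono: "W m \<subseteq> W n" if "m \<le> n" for m n
    unfolding W_def using that by (intro image_mono) (force intro: order_less_le_trans)
  have "topspace (quotient_topology isometry_topology ?q) \<subseteq> ?q ` ?I"
    using openin_topspace[of "quotient_topology isometry_topology ?q"]
    unfolding openin_quotient_topology top by blast
  also have "\<dots> \<subseteq> \<Union> (range W)"
  proof
    fix C assume "C \<in> ?q ` ?I"
    then obtain g where g: "g \<in> ?I" "C = ?q g" by blast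
    obtain n :: nat where "dist ((g \<circ> id) x\<^sub>0) x\<^sub>0 < real n" using reals_Archimedean2 by blast
    moreover have "id \<in> L" using subgroup.one_closed[OF L] by simp
    ultimately have "C \<in> W n" unfolding g(2) W[OF g(1)] by blast
    then show "C \<in> \<Union> (range W)" by blast
  qed
  finally have cover: "topspace (quotient_topology isometry_topology ?q) \<subseteq> \<Union> (range W)" .
  have "\<forall>U\<in>range W. openin (quotient_topology isometry_topology ?q) U" using openW by blast
  then obtain \<F> where \<F>: "finite \<F>" "\<F> \<subseteq> range W"
      "topspace (quotient_topology isometry_topology ?q) \<subseteq> \<Union>\<F>"
    using comp[unfolded compact_space_alt, rule_format, of "range W"] cover by blast
  obtain J where J: "finite J" "\<F> = W ` J" using \<F>(1,2) by (meson finite_subset_image)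
  define n where "n = Max (insert 0 J)"
  have "m \<le> n" if "m \<in> J" for m unfolding n_def using J(1) that by simp
  then have "\<Union>\<F> \<subseteq> W n" unfolding J(2) using mono by blast
  with \<F>(3) have topW: "topspace (quotient_topology isometry_topology ?q) \<subseteq> W n" by (rule order_trans)
  have "?q ` ?I \<subseteq> topspace (quotient_topology isometry_topology ?q)"
  proof (rule openin_subset)
    have "{g \<in> ?I. ?q g \<in> ?q ` ?I} = topspace isometry_topology" unfolding top by blast
    then show "openin (quotient_topology isometry_topology ?q) (?q ` ?I)"
      using openin_topspace[of "isometry_topology :: ('x \<Rightarrow> 'x) topology"]
      unfolding openin_quotient_topology top by simp
  qed
  then have "?q ` ?I \<subseteq> W n" using topW by (rule order_trans)
  then have qW: "?q g \<in> W n" if "g \<in> ?I" for g using that unfolding image_subset_iff by (rule bspec)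
  obtain K where K: "compact K" "(\<Union>f\<in>?I. f ` K) = UNIV"
    using assms(2) by (auto simp: cocompact_isometry_group_def)
  obtain c where c: "\<And>x. x \<in> K \<Longrightarrow> dist x\<^sub>0 x \<le> c"
    using compact_imp_bounded[OF K(1)] unfolding bounded_any_center[of K x\<^sub>0] by blast
  show ?thesis
  proof (rule that[of "real n + c"])
    fix x :: 'x
    have "x \<in> (\<Union>f\<in>?I. f ` K)" unfolding K(2) by (rule UNIV_I)
    then obtain f k where f: "f \<in> ?I" "k \<in> K" "x = f k" by (elim UN_E imageE)
    have "inv\<^bsub>isometry_group\<^esub> f \<in> ?I" using f by simp
    then obtain l where l: "l \<in> L" "dist ((inv\<^bsub>isometry_group\<^esub> f \<circ> l) x\<^sub>0) x\<^sub>0 < real n"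
      using W[of "inv\<^bsub>isometry_group\<^esub> f" n] qW[of "inv\<^bsub>isometry_group\<^esub> f"] by auto
    have "dist (l x\<^sub>0) (f x\<^sub>0) = dist ((inv\<^bsub>isometry_group\<^esub> f) (l x\<^sub>0)) x\<^sub>0"
      using isometry_groupD(2)[OF f(1), of "(inv\<^bsub>isometry_group\<^esub> f) (l x\<^sub>0)" x\<^sub>0] f
      by (simp add: isometry_inv_apply)
    moreover have "dist (f x\<^sub>0) (f k) \<le> c" using c f isometry_groupD(2)[OF f(1)] by simp
    ultimately have "dist (l x\<^sub>0) x \<le> real n + c"
      using l dist_triangle[of "l x\<^sub>0" x "f x\<^sub>0"] f by simp
    with l show "\<exists>h\<in>L. dist (h x\<^sub>0) x \<le> real n + c" by blast
  qed
qed

section \<open>The path group\<close>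

locale gog =
  fixes A :: "('v, 'e, 'a, 'b) graph_of_groups"
  assumes gog: "graph_of_groups A"
begin

lemma serre: "serre_graph A" and connected: "connected_graph A"
  using gog by (auto simp: graph_of_groups_def)

lemma ini_closed: "e \<in> edges A \<Longrightarrow> ini A e \<in> verts A"
  and bar_closed: "e \<in> edges A \<Longrightarrow> bar A e \<in> edges A"
  and bar_bar: "e \<in> edges A \<Longrightarrow> bar A (bar A e) = e"
  and bar_neq: "e \<in> edges A \<Longrightarrow> bar A e \<noteq> e"
  using serre by (auto simp: serre_graph_def)

lemma ter_closed: "e \<in> edges A \<Longrightarrow> ter A e \<in> verts A"
  by (intro ini_closed bar_closed)

lemma vgroup_group: "v \<in> verts A \<Longrightarrow> group (vgroup A v)"
  using gog by (auto simp: graph_of_groups_def)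

lemma egroup_group: "e \<in> edges A \<Longrightarrow> group (egroup A e)"
  and egroup_bar: "e \<in> edges A \<Longrightarrow> egroup A (bar A e) = egroup A e"
  and emono_hom: "e \<in> edges A \<Longrightarrow> emono A e \<in> hom (egroup A e) (vgroup A (ini A e))"
  using gog by (auto simp: graph_of_groups_def mon_def)

lemma emono_closed:
  "e \<in> edges A \<Longrightarrow> g \<in> carrier (egroup A e) \<Longrightarrow> emono A e g \<in> carrier (vgroup A (ini A e))"
  using emono_hom by (auto simp: hom_def)

lemma emono_bar_closed:
  "e \<in> edges A \<Longrightarrow> g \<in> carrier (egroup A e) \<Longrightarrow>
    emono A (bar A e) g \<in> carrier (vgroup A (ter A e))"
  using emono_closed[of "bar A e" g] by (simp add: bar_closed egroup_bar)

lemma path_words_Nil: "[] \<in> path_words A"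
  by (simp add: path_words_def)

lemma path_words_Cons: "x # w \<in> path_words A \<longleftrightarrow> letter_ok A x \<and> w \<in> path_words A"
  by (simp add: path_words_def)

lemma path_words_append: "u @ w \<in> path_words A \<longleftrightarrow> u \<in> path_words A \<and> w \<in> path_words A"
  by (auto simp: path_words_def)

lemmas path_words_simps = path_words_Nil path_words_Cons path_words_append

lemma path_equiv_words:
  assumes "path_equiv A w w'"
  shows "w \<in> path_words A" "w' \<in> path_words A"
proof -
  have "w \<in> path_words A \<and> w' \<in> path_words A" using assms
  proof (induction rule: path_equiv.induct)
    case (vertex_mult u w v g h)
    then show ?case using vgroup_group[of v] by (auto simp: path_words_simps monoid.m_closed group.is_monoid)
  next
    case (vertex_one u w v)
    then show ?case using vgroup_group[of v] by (auto simp: path_words_simps monoid.one_closed group.is_monoid)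
  next
    case (edge_inverse u w e)
    then show ?case by (auto simp: path_words_simps bar_closed)
  next
    case (edge_conj u w e g)
    then show ?case by (auto simp: path_words_simps bar_closed ini_closed ter_closed emono_closed emono_bar_closed)
  qed auto
  then show "w \<in> path_words A" "w' \<in> path_words A" by auto
qed

text \<open>The rules generating the congruence are stated with arbitrary surrounding words, so each of them
  is stable under enlarging the context.\<close>

lemma path_equiv_context:
  assumes "path_equiv A w w'" "p \<in> path_words A" "q \<in> path_words A"
  shows "path_equiv A (p @ w @ q) (p @ w' @ q)"
  using assms(1)
proof (induction rule: path_equiv.induct)
  case (refl w)
  then show ?case using assms by (intro path_equiv.refl) (simp add: path_words_simps)
next
  case (sym w w')
  from sym.IH show ?case by (rule path_equiv.sym)
next
  case (trans w w' w'')
  then show ?case by (blast intro: path_equiv.trans)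
next
  case (vertex_mult u w v g h)
  then show ?case using assms path_equiv.vertex_mult[of "p @ u" A "w @ q" v g h]
    by (simp add: path_words_simps)
next
  case (vertex_one u w v)
  then show ?case using assms path_equiv.vertex_one[of "p @ u" A "w @ q" v]
    by (simp add: path_words_simps)
next
  case (edge_inverse u w e)
  then show ?case using assms path_equiv.edge_inverse[of "p @ u" A "w @ q" e]
    by (simp add: path_words_simps)
next
  case (edge_conj u w e g)
  then show ?case using assms path_equiv.edge_conj[of "p @ u" A "w @ q" e g]
    by (simp add: path_words_simps)
qed

lemma path_class_self: "w \<in> path_words A \<Longrightarrow> w \<in> path_class A w"
  by (simp add: path_class_def path_equiv.refl)

lemma path_class_eqI: "path_equiv A w w' \<Longrightarrow> path_class A w = path_class A w'"
  unfolding path_class_def by (auto intro: path_equiv.sym path_equiv.trans)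

lemma path_class_carrier: "w \<in> path_words A \<Longrightarrow> path_class A w \<in> carrier (path_group A)"
  by (simp add: path_group_def)

text \<open>The product is defined through chosen representatives; by the congruence property any
  representatives may be used instead.\<close>

lemma path_class_mult:
  assumes "w \<in> path_words A" "w' \<in> path_words A"
  shows "path_class A w \<otimes>\<^bsub>path_group A\<^esub> path_class A w' = path_class A (w @ w')"
proof -
  let ?s = "SOME u. u \<in> path_class A w" and ?s' = "SOME u. u \<in> path_class A w'"
  have "?s \<in> path_class A w" "?s' \<in> path_class A w'"
    using path_class_self assms someI_ex[of "\<lambda>u. u \<in> path_class A w"]
      someI_ex[of "\<lambda>u. u \<in> path_class A w'"] by blast+
  then have eq: "path_equiv A w ?s" "path_equiv A w' ?s'" by (auto simp: path_class_def)
  have "path_equiv A (w @ w') (?s @ w')"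
    using path_equiv_context[OF eq(1) path_words_Nil assms(2)] by simp
  also have "path_equiv A (?s @ w') (?s @ ?s')" for s
    using path_equiv_context[OF eq(2) path_equiv_words(2)[OF eq(1)] path_words_Nil] by simp
  finally (path_equiv.trans) show ?thesis
    unfolding path_group_def using path_class_eqI by simp
qed

lemma path_group_one: "\<one>\<^bsub>path_group A\<^esub> = path_class A []"
  by (simp add: path_group_def)

lemma path_group_carrierE:
  assumes "x \<in> carrier (path_group A)"
  obtains w where "w \<in> path_words A" "x = path_class A w"
  using assms by (auto simp: path_group_def)

fun inv_letter :: "('v, 'e, 'a) letter \<Rightarrow> ('v, 'e, 'a) letter" where
  "inv_letter (VLetter v g) = VLetter v (inv\<^bsub>vgroup A v\<^esub> g)"
| "inv_letter (ELetter e) = ELetter (bar A e)"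

lemma inv_letter_ok: "letter_ok A x \<Longrightarrow> letter_ok A (inv_letter x)"
  by (cases x) (auto simp: vgroup_group bar_closed)

text \<open>A word for the inverse exists because every generator has an inverse among the generators.\<close>

definition inv_word :: "('v, 'e, 'a) letter list \<Rightarrow> ('v, 'e, 'a) letter list" where
  "inv_word w = rev (map inv_letter w)"

lemma inv_word_closed: "w \<in> path_words A \<Longrightarrow> inv_word w \<in> path_words A"
  by (auto simp: path_words_def inv_word_def inv_letter_ok)

lemma inv_letter_cancel:
  assumes "letter_ok A x" "u \<in> path_words A" "w \<in> path_words A"
  shows "path_equiv A (u @ [inv_letter x, x] @ w) (u @ w)"
proof (cases x)
  case (VLetter v g)
  then have v: "v \<in> verts A" "g \<in> carrier (vgroup A v)" using assms by auto
  interpret V: group "vgroup A v" by (rule vgroup_group[OF v(1)])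
  have "path_equiv A (u @ [VLetter v (inv\<^bsub>vgroup A v\<^esub> g), VLetter v g] @ w)
      (u @ [VLetter v (inv\<^bsub>vgroup A v\<^esub> g \<otimes>\<^bsub>vgroup A v\<^esub> g)] @ w)"
    using assms v by (intro path_equiv.vertex_mult) auto
  moreover have "path_equiv A (u @ [VLetter v \<one>\<^bsub>vgroup A v\<^esub>] @ w) (u @ w)"
    using assms v by (intro path_equiv.vertex_one) auto
  ultimately show ?thesis using v VLetter by (auto intro: path_equiv.trans)
next
  case (ELetter e)
  then show ?thesis using assms path_equiv.edge_inverse[of u A w "bar A e"]
    by (simp add: bar_closed bar_bar)
qed

lemma inv_word_cancel:
  "w \<in> path_words A \<Longrightarrow> path_equiv A (inv_word w @ w) []"
proof (induction w)
  case Nil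
  then show ?case by (auto simp: inv_word_def intro: path_equiv.refl)
next
  case (Cons x w)
  then have "path_equiv A (inv_word w @ [inv_letter x, x] @ w) (inv_word w @ w)"
    by (intro inv_letter_cancel) (auto simp: path_words_simps inv_word_closed)
  with Cons show ?case by (auto simp: inv_word_def path_words_simps intro: path_equiv.trans)
qed

lemma group_path_group: "group (path_group A)"
proof (rule groupI)
  fix x y z
  assume "x \<in> carrier (path_group A)" "y \<in> carrier (path_group A)" "z \<in> carrier (path_group A)"
  then obtain u v w where "u \<in> path_words A" "v \<in> path_words A" "w \<in> path_words A"
    "x = path_class A u" "y = path_class A v" "z = path_class A w" by (metis path_group_carrierE)
  then show "x \<otimes>\<^bsub>path_group A\<^esub> y \<otimes>\<^bsub>path_group A\<^esub> z = x \<otimes>\<^bsub>path_group A\<^esub> (y \<otimes>\<^bsub>path_group A\<^esub> z)"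
    by (simp add: path_class_mult path_words_simps)
next
  fix x y
  assume "x \<in> carrier (path_group A)" "y \<in> carrier (path_group A)"
  then obtain u v where "u \<in> path_words A" "v \<in> path_words A"
    "x = path_class A u" "y = path_class A v" by (metis path_group_carrierE)
  then show "x \<otimes>\<^bsub>path_group A\<^esub> y \<in> carrier (path_group A)"
    by (simp add: path_class_mult path_words_simps path_class_carrier)
next
  show "\<one>\<^bsub>path_group A\<^esub> \<in> carrier (path_group A)"
    by (simp add: path_group_one path_class_carrier path_words_Nil)
next
  fix x assume "x \<in> carrier (path_group A)"
  then obtain u where u: "u \<in> path_words A" "x = path_class A u" by (metis path_group_carrierE)
  then show "\<one>\<^bsub>path_group A\<^esub> \<otimes>\<^bsub>path_group A\<^esub> x = x"
    by (simp add: path_group_one path_class_mult path_words_Nil)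
  have "path_class A (inv_word u) \<otimes>\<^bsub>path_group A\<^esub> x = \<one>\<^bsub>path_group A\<^esub>"
    using u by (simp add: path_class_mult inv_word_closed path_group_one inv_word_cancel path_class_eqI)
  then show "\<exists>y\<in>carrier (path_group A). y \<otimes>\<^bsub>path_group A\<^esub> x = \<one>\<^bsub>path_group A\<^esub>"
    using u path_class_carrier inv_word_closed by blast
qed

sublocale P: group "path_group A" by (rule group_path_group)

lemma path_class_inv:
  assumes "w \<in> path_words A"
  shows "inv\<^bsub>path_group A\<^esub> path_class A w = path_class A (inv_word w)"
proof (rule P.inv_equality)
  show "path_class A (inv_word w) \<otimes>\<^bsub>path_group A\<^esub> path_class A w = \<one>\<^bsub>path_group A\<^esub>"
    using assms by (simp add: path_class_mult inv_word_closed path_group_one inv_word_cancel path_class_eqI)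
qed (auto simp: assms path_class_carrier inv_word_closed)

section \<open>Path elements and the fundamental group\<close>

lemma word_along_words: "word_along A a w b \<Longrightarrow> w \<in> path_words A"
proof (induction w arbitrary: a)
  case (Cons x w)
  then show ?case by (cases x) (auto simp: path_words_simps)
qed (simp add: path_words_Nil)

lemma word_along_append: "word_along A a u b \<Longrightarrow> word_along A b w c \<Longrightarrow> word_along A a (u @ w) c"
proof (induction u arbitrary: a)
  case (Cons x u)
  then show ?case by (cases x) auto
qed simp

lemma word_along_inv: "word_along A a w b \<Longrightarrow> word_along A b (inv_word w) a"
proof (induction w arbitrary: a)
  case (Cons x w)
  show ?case
  proof (cases x)
    case (VLetter v g)
    with Cons have "word_along A b (inv_word w) a"
      "word_along A a [VLetter v (inv\<^bsub>vgroup A v\<^esub> g)] a"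
      using vgroup_group[of v] by auto
    from word_along_append[OF this] VLetter show ?thesis by (simp add: inv_word_def)
  next
    case (ELetter e)
    with Cons have "word_along A b (inv_word w) (ter A e)"
      "word_along A (ter A e) [ELetter (bar A e)] a"
      by (auto simp: bar_closed bar_bar ini_closed)
    from word_along_append[OF this] ELetter show ?thesis by (simp add: inv_word_def)
  qed
qed (simp add: inv_word_def)

lemma paths_closed: "p \<in> paths_between A a b \<Longrightarrow> p \<in> carrier (path_group A)"
  by (auto simp: paths_between_def intro: path_class_carrier word_along_words)

lemma paths_mult:
  "p \<in> paths_between A a b \<Longrightarrow> q \<in> paths_between A b c \<Longrightarrow>
    p \<otimes>\<^bsub>path_group A\<^esub> q \<in> paths_between A a c"
  unfolding paths_between_def by (auto simp: path_class_mult word_along_words intro: word_along_append)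

lemma paths_inv: "p \<in> paths_between A a b \<Longrightarrow> inv\<^bsub>path_group A\<^esub> p \<in> paths_between A b a"
  unfolding paths_between_def by (auto simp: path_class_inv word_along_words intro: word_along_inv)

lemma paths_one: "a \<in> verts A \<Longrightarrow> \<one>\<^bsub>path_group A\<^esub> \<in> paths_between A a a"
  unfolding paths_between_def path_group_one by (intro imageI) simp

lemma subgroup_paths: "a \<in> verts A \<Longrightarrow> subgroup (paths_between A a a) (path_group A)"
  using paths_closed paths_mult paths_inv paths_one by unfold_locales blast+

lemma group_fundamental_group: "a \<in> verts A \<Longrightarrow> group (fundamental_group A a)"
  unfolding fundamental_group_def by (rule subgroup.subgroup_is_group[OF subgroup_paths group_path_group])

lemma fundamental_group_simps:
  "carrier (fundamental_group A a) = paths_between A a a"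
  "x \<otimes>\<^bsub>fundamental_group A a\<^esub> y = x \<otimes>\<^bsub>path_group A\<^esub> y"
  "\<one>\<^bsub>fundamental_group A a\<^esub> = \<one>\<^bsub>path_group A\<^esub>"
  by (simp_all add: fundamental_group_def)

lemma vertex_word_hom:
  "v \<in> verts A \<Longrightarrow> (\<lambda>g. path_class A [VLetter v g]) \<in> hom (vgroup A v) (path_group A)"
  using path_equiv.vertex_mult[of "[]" A "[]" v]
  by (intro homI) (auto simp: path_class_carrier path_words_simps path_class_mult
      intro!: path_class_eqI[symmetric])

lemma vertex_subgroup_subgroup: "v \<in> verts A \<Longrightarrow> subgroup (vertex_subgroup A v) (path_group A)"
  unfolding vertex_subgroup_def
  by (intro group_hom.img_is_subgroup group_hom.intro group_hom_axioms.intro vgroup_group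
      group_path_group vertex_word_hom)

lemma vertex_subgroup_paths: "v \<in> verts A \<Longrightarrow> vertex_subgroup A v \<subseteq> paths_between A v v"
  unfolding vertex_subgroup_def paths_between_def by auto

lemma edge_subgroup_subgroup:
  assumes "e \<in> edges A"
  shows "subgroup (edge_subgroup A e) (path_group A)"
proof -
  have "(\<lambda>g. path_class A [VLetter (ini A e) g]) \<circ> emono A e \<in> hom (egroup A e) (path_group A)"
    using assms by (intro hom_compose[OF emono_hom vertex_word_hom]) (auto simp: ini_closed)
  then have "group_hom (egroup A e) (path_group A) ((\<lambda>g. path_class A [VLetter (ini A e) g]) \<circ> emono A e)"
    using assms by (intro group_hom.intro group_hom_axioms.intro egroup_group group_path_group)
  from group_hom.img_is_subgroup[OF this] show ?thesis
    by (simp add: edge_subgroup_def o_def)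
qed

lemma edge_subgroup_le: "e \<in> edges A \<Longrightarrow> edge_subgroup A e \<subseteq> vertex_subgroup A (ini A e)"
  unfolding edge_subgroup_def vertex_subgroup_def using emono_closed by auto

lemma edge_elt_paths: "e \<in> edges A \<Longrightarrow> path_class A [ELetter e] \<in> paths_between A (ini A e) (ter A e)"
  unfolding paths_between_def by (intro imageI) (simp add: ter_closed)

lemma edge_elt_carrier: "e \<in> edges A \<Longrightarrow> path_class A [ELetter e] \<in> carrier (path_group A)"
  using edge_elt_paths paths_closed by blast

lemma edge_elt_bar:
  "e \<in> edges A \<Longrightarrow>
    path_class A [ELetter e] \<otimes>\<^bsub>path_group A\<^esub> path_class A [ELetter (bar A e)] = \<one>\<^bsub>path_group A\<^esub>"
  using path_equiv.edge_inverse[of "[]" A "[]" e]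
  by (auto simp: path_class_mult path_words_simps bar_closed path_group_one intro!: path_class_eqI)

text \<open>The relation \<open>t\<^sub>e \<alpha>\<^bsub>bar e\<^esub>(g) = \<alpha>\<^sub>e(g) t\<^sub>e\<close>, for all \<open>g\<close> at once.\<close>

lemma edge_subgroup_swap:
  assumes "e \<in> edges A"
  shows "edge_subgroup A e #>\<^bsub>path_group A\<^esub> path_class A [ELetter e] =
    path_class A [ELetter e] <#\<^bsub>path_group A\<^esub> edge_subgroup A (bar A e)"
proof -
  have "path_class A [VLetter (ini A e) (emono A e g)] \<otimes>\<^bsub>path_group A\<^esub> path_class A [ELetter e] =
      path_class A [ELetter e] \<otimes>\<^bsub>path_group A\<^esub> path_class A [VLetter (ter A e) (emono A (bar A e) g)]"
    if g: "g \<in> carrier (egroup A e)" for g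
  proof -
    have ok: "letter_ok A (VLetter (ini A e) (emono A e g))"
        "letter_ok A (VLetter (ter A e) (emono A (bar A e) g))"
        "letter_ok A (ELetter e)" "letter_ok A (ELetter (bar A e))"
      using assms g by (auto simp: ini_closed ter_closed bar_closed emono_closed emono_bar_closed)
    have "path_equiv A ([] @ [ELetter e, VLetter (ter A e) (emono A (bar A e) g), ELetter (bar A e)] @ [ELetter e])
        ([] @ [VLetter (ini A e) (emono A e g)] @ [ELetter e])"
      using assms g ok by (intro path_equiv.edge_conj) (simp_all add: path_words_simps)
    moreover have "path_equiv A ([ELetter e, VLetter (ter A e) (emono A (bar A e) g)] @
        [ELetter (bar A e), ELetter (bar A (bar A e))] @ [])
        ([ELetter e, VLetter (ter A e) (emono A (bar A e) g)] @ [])"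
      using assms g ok by (intro path_equiv.edge_inverse) (simp_all add: path_words_simps)
    ultimately have "path_equiv A [VLetter (ini A e) (emono A e g), ELetter e]
        [ELetter e, VLetter (ter A e) (emono A (bar A e) g)]"
      using assms by (auto simp: bar_bar intro: path_equiv.sym path_equiv.trans)
    from path_class_eqI[OF this] show ?thesis
      using ok by (simp add: path_class_mult path_words_simps)
  qed
  then show ?thesis
    unfolding r_coset_def l_coset_def edge_subgroup_def using assms
    by (simp add: egroup_bar)
qed

section \<open>The induced homomorphism\<close>

context
  fixes H :: "'h monoid" and \<psi> :: "('v, 'e, 'a, 'b, 'h) gog_morphism"
  assumes H: "group H" and \<psi>: "morphism_to_group A H \<psi>"
begin

interpretation H: group H by (rule H)

lemma vhom_hom: "v \<in> verts A \<Longrightarrow> vhom \<psi> v \<in> hom (vgroup A v) H"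
  and velt_closed: "v \<in> verts A \<Longrightarrow> velt \<psi> v \<in> carrier H"
  and ehom_hom: "e \<in> edges A \<Longrightarrow> ehom \<psi> e \<in> hom (egroup A e) H"
  and eelt_closed: "e \<in> edges A \<Longrightarrow> eelt \<psi> e \<in> carrier H"
  and ehom_bar: "e \<in> edges A \<Longrightarrow> g \<in> carrier (egroup A e) \<Longrightarrow> ehom \<psi> (bar A e) g = ehom \<psi> e g"
  and vhom_emono: "e \<in> edges A \<Longrightarrow> g \<in> carrier (egroup A e) \<Longrightarrow>
    vhom \<psi> (ini A e) (emono A e g) =
      (inv\<^bsub>H\<^esub> velt \<psi> (ini A e) \<otimes>\<^bsub>H\<^esub> eelt \<psi> e) \<otimes>\<^bsub>H\<^esub> ehom \<psi> e g \<otimes>\<^bsub>H\<^esub>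
      inv\<^bsub>H\<^esub> (inv\<^bsub>H\<^esub> velt \<psi> (ini A e) \<otimes>\<^bsub>H\<^esub> eelt \<psi> e)"
  using \<psi> by (auto simp: morphism_to_group_def Let_def)

lemma letter_image_closed: "letter_ok A x \<Longrightarrow> letter_image A H \<psi> x \<in> carrier H"
  by (cases x) (auto simp: velt_closed eelt_closed bar_closed
      intro!: H.m_closed hom_in_carrier[OF vhom_hom])

lemma word_image_closed: "w \<in> path_words A \<Longrightarrow> word_image A H \<psi> w \<in> carrier H"
  by (induction w) (auto simp: word_image_def path_words_simps letter_image_closed)

lemma word_image_Cons:
  "word_image A H \<psi> (x # w) = letter_image A H \<psi> x \<otimes>\<^bsub>H\<^esub> word_image A H \<psi> w"
  by (simp add: word_image_def)

lemma word_image_append: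
  "u \<in> path_words A \<Longrightarrow> w \<in> path_words A \<Longrightarrow>
    word_image A H \<psi> (u @ w) = word_image A H \<psi> u \<otimes>\<^bsub>H\<^esub> word_image A H \<psi> w"
proof (induction u)
  case Nil
  then show ?case using word_image_closed[of w] by (simp add: word_image_def)
next
  case (Cons x u)
  then show ?case using word_image_closed[of u] word_image_closed[of w] letter_image_closed[of x]
    by (simp add: word_image_Cons path_words_simps H.m_assoc)
qed

lemma inv_cancel_left [simp]:
  "x \<in> carrier H \<Longrightarrow> y \<in> carrier H \<Longrightarrow> x \<otimes>\<^bsub>H\<^esub> (inv\<^bsub>H\<^esub> x \<otimes>\<^bsub>H\<^esub> y) = y"
  "x \<in> carrier H \<Longrightarrow> y \<in> carrier H \<Longrightarrow> inv\<^bsub>H\<^esub> x \<otimes>\<^bsub>H\<^esub> (x \<otimes>\<^bsub>H\<^esub> y) = y"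
  by (simp_all add: H.m_assoc[symmetric])

lemma letter_image_emono:
  assumes "e \<in> edges A" "g \<in> carrier (egroup A e)"
  shows "letter_image A H \<psi> (VLetter (ini A e) (emono A e g)) =
    eelt \<psi> e \<otimes>\<^bsub>H\<^esub> ehom \<psi> e g \<otimes>\<^bsub>H\<^esub> inv\<^bsub>H\<^esub> eelt \<psi> e"
proof -
  have "velt \<psi> (ini A e) \<in> carrier H" "eelt \<psi> e \<in> carrier H" "ehom \<psi> e g \<in> carrier H"
    using assms ehom_hom by (auto simp: velt_closed eelt_closed ini_closed hom_def)
  then show ?thesis
    by (simp add: vhom_emono[OF assms] H.inv_mult_group H.m_assoc)
qed

text \<open>Substituting the relation between the vertex and edge homomorphisms, both sides of the
  edge relation become \<open>h\<^sub>e \<psi>\<^sub>e(g) h\<^sub>e\<^sup>-\<^sup>1\<close>.\<close>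

lemma word_image_path_equiv:
  "path_equiv A w w' \<Longrightarrow> word_image A H \<psi> w = word_image A H \<psi> w'"
proof (induction rule: path_equiv.induct)
  case (vertex_mult u w v g h)
  interpret V: group "vgroup A v" using vertex_mult vgroup_group by blast
  have "velt \<psi> v \<in> carrier H" "vhom \<psi> v g \<in> carrier H" "vhom \<psi> v h \<in> carrier H"
    "vhom \<psi> v (g \<otimes>\<^bsub>vgroup A v\<^esub> h) = vhom \<psi> v g \<otimes>\<^bsub>H\<^esub> vhom \<psi> v h"
    using vertex_mult vhom_hom[of v] by (auto simp: velt_closed hom_def)
  with vertex_mult show ?case using word_image_closed[of w] word_image_closed[of u]
    by (simp add: word_image_append word_image_Cons path_words_simps H.m_assoc)
next
  case (vertex_one u w v)
  interpret V: group "vgroup A v" using vertex_one vgroup_group by blast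
  have "velt \<psi> v \<in> carrier H" "vhom \<psi> v \<one>\<^bsub>vgroup A v\<^esub> = \<one>\<^bsub>H\<^esub>"
    using vertex_one vhom_hom[of v] V.is_group H.is_group by (auto simp: velt_closed intro: hom_one)
  with vertex_one show ?case using word_image_closed[of w] word_image_closed[of u]
    by (simp add: word_image_append word_image_Cons path_words_simps H.m_assoc)
next
  case (edge_inverse u w e)
  then have "eelt \<psi> e \<in> carrier H" "eelt \<psi> (bar A e) \<in> carrier H"
    by (auto simp: eelt_closed bar_closed)
  with edge_inverse show ?case using word_image_closed[of w] word_image_closed[of u]
    by (simp add: word_image_append word_image_Cons path_words_simps H.m_assoc bar_closed bar_bar)
next
  case (edge_conj u w e g)
  have ok: "letter_ok A (VLetter (ini A e) (emono A e g))"
      "letter_ok A (VLetter (ter A e) (emono A (bar A e) g))"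
      "letter_ok A (ELetter e)" "letter_ok A (ELetter (bar A e))"
    using edge_conj by (auto simp: ini_closed ter_closed bar_closed emono_closed emono_bar_closed)
  have cl: "eelt \<psi> e \<in> carrier H" "eelt \<psi> (bar A e) \<in> carrier H" "ehom \<psi> e g \<in> carrier H"
    using edge_conj ehom_hom[of e] by (auto simp: eelt_closed bar_closed hom_def)
  have img: "letter_image A H \<psi> (VLetter (ini A e) (emono A e g)) =
      eelt \<psi> e \<otimes>\<^bsub>H\<^esub> ehom \<psi> e g \<otimes>\<^bsub>H\<^esub> inv\<^bsub>H\<^esub> eelt \<psi> e"
    "letter_image A H \<psi> (VLetter (ter A e) (emono A (bar A e) g)) =
      eelt \<psi> (bar A e) \<otimes>\<^bsub>H\<^esub> ehom \<psi> e g \<otimes>\<^bsub>H\<^esub> inv\<^bsub>H\<^esub> eelt \<psi> (bar A e)"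
    using letter_image_emono[of e g] letter_image_emono[of "bar A e" g] edge_conj
    by (simp_all add: bar_closed egroup_bar ehom_bar)
  show ?case using word_image_closed[of w] word_image_closed[of u] edge_conj ok cl
    by (simp add: word_image_append word_image_Cons path_words_simps bar_bar img H.m_assoc
        del: letter_image.simps(1))
qed auto

lemma induced_hom_class:
  assumes "w \<in> path_words A"
  shows "induced_hom A H \<psi> (path_class A w) = word_image A H \<psi> w"
proof -
  have "word_image A H \<psi> ` path_class A w = {word_image A H \<psi> w}"
  proof (intro equalityI image_subsetI)
    fix u assume "u \<in> path_class A w"
    then have "path_equiv A w u" by (simp add: path_class_def)
    from word_image_path_equiv[OF this] show "word_image A H \<psi> u \<in> {word_image A H \<psi> w}" by simp
  next
    show "{word_image A H \<psi> w} \<subseteq> word_image A H \<psi> ` path_class A w"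
      using path_class_self[OF assms] by simp
  qed
  then show ?thesis by (simp add: induced_hom_def)
qed

lemma induced_hom_hom: "induced_hom A H \<psi> \<in> hom (path_group A) H"
proof (rule homI)
  fix x y assume "x \<in> carrier (path_group A)" "y \<in> carrier (path_group A)"
  then obtain u w where "u \<in> path_words A" "w \<in> path_words A"
    "x = path_class A u" "y = path_class A w" by (metis path_group_carrierE)
  then show "induced_hom A H \<psi> (x \<otimes>\<^bsub>path_group A\<^esub> y) = induced_hom A H \<psi> x \<otimes>\<^bsub>H\<^esub> induced_hom A H \<psi> y"
    by (simp add: path_class_mult induced_hom_class word_image_append path_words_simps)
qed (auto elim!: path_group_carrierE simp: induced_hom_class word_image_closed)

end

end

section \<open>The Bass--Serre graph and the action of the fundamental group\<close>

locale pointed_gog = gog A for A :: "('v, 'e, 'a, 'b) graph_of_groups" +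
  fixes a :: 'v
  assumes base_vert: "a \<in> verts A"
begin

abbreviation T where "T \<equiv> bass_serre_tree A a"

abbreviation base where "base \<equiv> (a, vertex_subgroup A a)"

lemma vertex_subgroup_carrier: "v \<in> verts A \<Longrightarrow> vertex_subgroup A v \<subseteq> carrier (path_group A)"
  using vertex_subgroup_subgroup subgroup.subset by blast

lemma edge_subgroup_carrier: "e \<in> edges A \<Longrightarrow> edge_subgroup A e \<subseteq> carrier (path_group A)"
  using edge_subgroup_subgroup subgroup.subset by blast

lemma tree_vertI:
  "v \<in> verts A \<Longrightarrow> p \<in> paths_between A a v \<Longrightarrow>
    (v, p <#\<^bsub>path_group A\<^esub> vertex_subgroup A v) \<in> verts T"
  unfolding bass_serre_tree_def by auto

lemma tree_vertE:
  assumes "x \<in> verts T"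
  obtains v p where "v \<in> verts A" "p \<in> paths_between A a v"
    "x = (v, p <#\<^bsub>path_group A\<^esub> vertex_subgroup A v)"
  using assms that unfolding bass_serre_tree_def by auto

lemma tree_edgeI:
  "e \<in> edges A \<Longrightarrow> p \<in> paths_between A a (ini A e) \<Longrightarrow>
    (e, p <#\<^bsub>path_group A\<^esub> edge_subgroup A e) \<in> edges T"
  unfolding bass_serre_tree_def by auto

lemma tree_edgeE:
  assumes "x \<in> edges T"
  obtains e p where "e \<in> edges A" "p \<in> paths_between A a (ini A e)"
    "x = (e, p <#\<^bsub>path_group A\<^esub> edge_subgroup A e)"
  using assms that unfolding bass_serre_tree_def by auto

text \<open>The initial vertex of an edge is read off its coset: multiplying by the vertex group absorbs the
  edge group, which is contained in it.\<close>

lemma tree_ini: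
  assumes e: "e \<in> edges A" and p: "p \<in> carrier (path_group A)"
  shows "ini T (e, p <#\<^bsub>path_group A\<^esub> edge_subgroup A e) =
    (ini A e, p <#\<^bsub>path_group A\<^esub> vertex_subgroup A (ini A e))"
proof -
  have V: "subgroup (vertex_subgroup A (ini A e)) (path_group A)"
    using e by (intro vertex_subgroup_subgroup ini_closed)
  have EV: "edge_subgroup A e \<subseteq> vertex_subgroup A (ini A e)" using e by (rule edge_subgroup_le)
  have oneE: "\<one>\<^bsub>path_group A\<^esub> \<in> edge_subgroup A e"
    using edge_subgroup_subgroup[OF e] by (rule subgroup.one_closed)
  have "edge_subgroup A e <#>\<^bsub>path_group A\<^esub> vertex_subgroup A (ini A e) = vertex_subgroup A (ini A e)"
  proof
    show "edge_subgroup A e <#>\<^bsub>path_group A\<^esub> vertex_subgroup A (ini A e) \<subseteq> vertex_subgroup A (ini A e)"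
      unfolding set_mult_def using EV subgroup.m_closed[OF V] by auto
    show "vertex_subgroup A (ini A e) \<subseteq> edge_subgroup A e <#>\<^bsub>path_group A\<^esub> vertex_subgroup A (ini A e)"
    proof
      fix g assume g: "g \<in> vertex_subgroup A (ini A e)"
      then have "\<one>\<^bsub>path_group A\<^esub> \<otimes>\<^bsub>path_group A\<^esub> g = g" using subgroup.mem_carrier[OF V] by simp
      with oneE g show "g \<in> edge_subgroup A e <#>\<^bsub>path_group A\<^esub> vertex_subgroup A (ini A e)"
        unfolding set_mult_def by (metis (no_types, lifting) UN_iff singletonI)
    qed
  qed
  then show ?thesis
    using P.setmult_lcos_assoc[OF edge_subgroup_carrier[OF e] subgroup.subset[OF V] p]
    by (simp add: bass_serre_tree_def)
qed

text \<open>Crossing \<open>e\<close> moves the edge group to the other side of \<open>t\<^sub>e\<close>, where it becomes the image at the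
  other end.\<close>

lemma tree_bar:
  assumes e: "e \<in> edges A" and p: "p \<in> carrier (path_group A)"
  shows "bar T (e, p <#\<^bsub>path_group A\<^esub> edge_subgroup A e) =
    (bar A e, (p \<otimes>\<^bsub>path_group A\<^esub> path_class A [ELetter e]) <#\<^bsub>path_group A\<^esub> edge_subgroup A (bar A e))"
  using P.coset_assoc[OF p edge_elt_carrier[OF e] edge_subgroup_carrier[OF e]] edge_subgroup_swap[OF e]
    P.lcos_m_assoc[OF edge_subgroup_carrier[OF bar_closed[OF e]] p edge_elt_carrier[OF e]]
  by (simp add: bass_serre_tree_def)

lemma tree_ter:
  assumes e: "e \<in> edges A" and p: "p \<in> carrier (path_group A)"
  shows "ter T (e, p <#\<^bsub>path_group A\<^esub> edge_subgroup A e) =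
    (ter A e, (p \<otimes>\<^bsub>path_group A\<^esub> path_class A [ELetter e]) <#\<^bsub>path_group A\<^esub>
      vertex_subgroup A (ter A e))"
  unfolding tree_bar[OF assms] using e p
  by (intro tree_ini bar_closed P.m_closed edge_elt_carrier)

lemma serre_tree: "serre_graph T"
  unfolding serre_graph_def
proof
  fix x assume "x \<in> edges T"
  then obtain e p where e: "e \<in> edges A" and p: "p \<in> paths_between A a (ini A e)"
    and x: "x = (e, p <#\<^bsub>path_group A\<^esub> edge_subgroup A e)" by (rule tree_edgeE)
  note pc = paths_closed[OF p]
  have pt: "p \<otimes>\<^bsub>path_group A\<^esub> path_class A [ELetter e] \<in> paths_between A a (ter A e)"
    using p edge_elt_paths[OF e] by (rule paths_mult)
  have "p \<otimes>\<^bsub>path_group A\<^esub> path_class A [ELetter e] \<otimes>\<^bsub>path_group A\<^esub> path_class A [ELetter (bar A e)] = p"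
    using pc e edge_elt_bar[OF e] by (simp add: P.m_assoc edge_elt_carrier bar_closed)
  then have "bar T (bar T x) = x"
    unfolding x tree_bar[OF e pc] tree_bar[OF bar_closed[OF e] paths_closed[OF pt]]
    using e by (simp add: bar_bar)
  moreover have "ini T x \<in> verts T"
    unfolding x tree_ini[OF e pc] using e p by (intro tree_vertI ini_closed)
  moreover have "bar T x \<in> edges T"
    unfolding x tree_bar[OF e pc] using e pt by (intro tree_edgeI bar_closed) auto
  moreover have "bar T x \<noteq> x"
    unfolding x tree_bar[OF e pc] using bar_neq[OF e] by simp
  ultimately show "ini T x \<in> verts T \<and> bar T x \<in> edges T \<and> bar T x \<noteq> x \<and> bar T (bar T x) = x"
    by blast
qed

text \<open>A word along a path in the graph of groups lifts to an edge path: its vertex letters do not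
  change the current coset, and its edge letters are crossed one at a time.\<close>

lemma tree_path_of_word:
  assumes "word_along A v w u" "p \<in> paths_between A a v"
  shows "\<exists>es. edge_path T (v, p <#\<^bsub>path_group A\<^esub> vertex_subgroup A v) es
      (u, (p \<otimes>\<^bsub>path_group A\<^esub> path_class A w) <#\<^bsub>path_group A\<^esub> vertex_subgroup A u) \<and>
    length es \<le> length w"
  using assms
proof (induction w arbitrary: v p)
  case Nil
  then have "p \<otimes>\<^bsub>path_group A\<^esub> path_class A [] = p" "v = u" "v \<in> verts A"
    using paths_closed by (auto simp: path_group_one[symmetric])
  then show ?case using Nil by (intro exI[of _ "[]"]) (auto intro: tree_vertI)
next
  case (Cons x w)
  have xw: "letter_ok A x" "w \<in> path_words A"
    using word_along_words[OF Cons.prems(1)] by (auto simp: path_words_simps)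
  note pc = paths_closed[OF Cons.prems(2)]
  have x: "path_class A [x] \<in> carrier (path_group A)"
    using xw by (intro path_class_carrier) (simp add: path_words_simps)
  have xw_class: "path_class A (x # w) = path_class A [x] \<otimes>\<^bsub>path_group A\<^esub> path_class A w"
    using xw by (simp add: path_class_mult path_words_simps)
  have assoc: "p \<otimes>\<^bsub>path_group A\<^esub> path_class A [x] \<otimes>\<^bsub>path_group A\<^esub> path_class A w =
      p \<otimes>\<^bsub>path_group A\<^esub> path_class A (x # w)"
    unfolding xw_class using pc x path_class_carrier[OF xw(2)] by (rule P.m_assoc)
  show ?case
  proof (cases x)
    case (VLetter v' g)
    then have v: "v' = v" "v \<in> verts A" "g \<in> carrier (vgroup A v)" "word_along A v w u"
      using Cons.prems by auto
    have xV: "path_class A [x] \<in> vertex_subgroup A v"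
      using VLetter v by (simp add: vertex_subgroup_def)
    then have "p \<otimes>\<^bsub>path_group A\<^esub> path_class A [x] \<in> paths_between A a v"
      using Cons.prems(2) vertex_subgroup_paths[OF v(2)] by (blast intro: paths_mult)
    from Cons.IH[OF v(4) this] obtain es where es:
      "edge_path T (v, (p \<otimes>\<^bsub>path_group A\<^esub> path_class A [x]) <#\<^bsub>path_group A\<^esub> vertex_subgroup A v) es
        (u, (p \<otimes>\<^bsub>path_group A\<^esub> path_class A (x # w)) <#\<^bsub>path_group A\<^esub> vertex_subgroup A u)"
      "length es \<le> length w" unfolding assoc by blast
    have "(p \<otimes>\<^bsub>path_group A\<^esub> path_class A [x]) <#\<^bsub>path_group A\<^esub> vertex_subgroup A v =
        p <#\<^bsub>path_group A\<^esub> vertex_subgroup A v"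
      using P.lcos_m_assoc[OF vertex_subgroup_carrier[OF v(2)] pc x]
        P.coset_join3[OF x vertex_subgroup_subgroup[OF v(2)] xV] by simp
    with es show ?thesis by (intro exI[of _ es]) auto
  next
    case (ELetter e)
    then have e: "e \<in> edges A" "ini A e = v" "word_along A (ter A e) w u" using Cons.prems by auto
    have "p \<otimes>\<^bsub>path_group A\<^esub> path_class A [x] \<in> paths_between A a (ter A e)"
      using Cons.prems(2) edge_elt_paths[OF e(1)] unfolding ELetter e(2) by (rule paths_mult)
    from Cons.IH[OF e(3) this] obtain es where es:
      "edge_path T (ter A e, (p \<otimes>\<^bsub>path_group A\<^esub> path_class A [x]) <#\<^bsub>path_group A\<^esub>
          vertex_subgroup A (ter A e)) es
        (u, (p \<otimes>\<^bsub>path_group A\<^esub> path_class A (x # w)) <#\<^bsub>path_group A\<^esub> vertex_subgroup A u)"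
      "length es \<le> length w" unfolding assoc by blast
    have "edge_path T (v, p <#\<^bsub>path_group A\<^esub> vertex_subgroup A v)
        ((e, p <#\<^bsub>path_group A\<^esub> edge_subgroup A e) # es)
        (u, (p \<otimes>\<^bsub>path_group A\<^esub> path_class A (x # w)) <#\<^bsub>path_group A\<^esub> vertex_subgroup A u)"
      using es(1) tree_edgeI[of e p] e Cons.prems(2) tree_ini[OF e(1) pc] tree_ter[OF e(1) pc]
      by (simp add: ELetter)
    with es(2) show ?thesis by (intro exI[of _ "(e, p <#\<^bsub>path_group A\<^esub> edge_subgroup A e) # es"]) auto
  qed
qed

lemma base_eq: "\<one>\<^bsub>path_group A\<^esub> <#\<^bsub>path_group A\<^esub> vertex_subgroup A a = vertex_subgroup A a"
  using vertex_subgroup_carrier[OF base_vert] by (rule P.lcos_mult_one)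

lemma base_in_tree: "base \<in> verts T"
  using tree_vertI[OF base_vert paths_one[OF base_vert]] by (simp add: base_eq)

lemma connected_tree: "connected_graph T"
proof -
  have from_base: "\<exists>es. edge_path T base es x" if "x \<in> verts T" for x
  proof -
    obtain v p where v: "v \<in> verts A" "p \<in> paths_between A a v"
      "x = (v, p <#\<^bsub>path_group A\<^esub> vertex_subgroup A v)" using \<open>x \<in> verts T\<close> by (rule tree_vertE)
    obtain w where w: "word_along A a w v" "p = path_class A w"
      using v(2) by (auto simp: paths_between_def)
    show ?thesis
      using tree_path_of_word[OF w(1) paths_one[OF base_vert]] paths_closed[OF v(2)]
      unfolding base_eq v(3) w(2) by auto
  qed
  have "\<exists>es. edge_path T x es y" if xy: "x \<in> verts T" "y \<in> verts T" for x y
  proof -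
    obtain es fs where es: "edge_path T base es x" "edge_path T base fs y"
      using from_base xy by blast
    show ?thesis using edge_path_append[OF serre_tree edge_path_rev[OF serre_tree es(1)] es(2)] by blast
  qed
  then show ?thesis unfolding connected_graph_def using base_in_tree by blast
qed

lemma tree_action_coset:
  assumes "\<gamma> \<in> carrier (path_group A)" "p \<in> carrier (path_group A)" "M \<subseteq> carrier (path_group A)"
  shows "tree_action A \<gamma> (\<sigma>, p <#\<^bsub>path_group A\<^esub> M) =
    (\<sigma>, (\<gamma> \<otimes>\<^bsub>path_group A\<^esub> p) <#\<^bsub>path_group A\<^esub> M)"
  using P.lcos_m_assoc[OF assms(3,1,2)] by (simp add: tree_action_def)

lemma tree_action_vert:
  assumes "\<gamma> \<in> paths_between A a a" "x \<in> verts T"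
  shows "tree_action A \<gamma> x \<in> verts T"
proof -
  obtain v p where v: "v \<in> verts A" "p \<in> paths_between A a v"
    "x = (v, p <#\<^bsub>path_group A\<^esub> vertex_subgroup A v)" using assms(2) by (rule tree_vertE)
  show ?thesis
    unfolding v(3)
      tree_action_coset[OF paths_closed[OF assms(1)] paths_closed[OF v(2)] vertex_subgroup_carrier[OF v(1)]]
    using v(1) paths_mult[OF assms(1) v(2)] by (rule tree_vertI)
qed

lemma tree_action_one: "x \<in> verts T \<Longrightarrow> tree_action A \<one>\<^bsub>path_group A\<^esub> x = x"
  by (erule tree_vertE) (simp add: tree_action_coset paths_closed vertex_subgroup_carrier)

lemma tree_action_mult:
  assumes "\<gamma> \<in> paths_between A a a" "\<delta> \<in> paths_between A a a" "x \<in> verts T"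
  shows "tree_action A (\<gamma> \<otimes>\<^bsub>path_group A\<^esub> \<delta>) x = tree_action A \<gamma> (tree_action A \<delta> x)"
proof -
  obtain v p where v: "v \<in> verts A" "p \<in> paths_between A a v"
    "x = (v, p <#\<^bsub>path_group A\<^esub> vertex_subgroup A v)" using assms(3) by (rule tree_vertE)
  show ?thesis unfolding v(3)
    using assms(1,2) v(1,2) by (simp add: tree_action_coset paths_closed vertex_subgroup_carrier P.m_assoc)
qed

lemma tree_action_edge:
  assumes "\<gamma> \<in> paths_between A a a" "x \<in> edges T"
  shows "tree_action A \<gamma> x \<in> edges T" "ini T (tree_action A \<gamma> x) = tree_action A \<gamma> (ini T x)"
    "ter T (tree_action A \<gamma> x) = tree_action A \<gamma> (ter T x)"
proof -
  obtain e p where e: "e \<in> edges A" and p: "p \<in> paths_between A a (ini A e)"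
    and x: "x = (e, p <#\<^bsub>path_group A\<^esub> edge_subgroup A e)" using assms(2) by (rule tree_edgeE)
  note gc = paths_closed[OF assms(1)] and pc = paths_closed[OF p] and tc = edge_elt_carrier[OF e]
  have act: "tree_action A \<gamma> x = (e, (\<gamma> \<otimes>\<^bsub>path_group A\<^esub> p) <#\<^bsub>path_group A\<^esub> edge_subgroup A e)"
    unfolding x by (rule tree_action_coset[OF gc pc edge_subgroup_carrier[OF e]])
  show "tree_action A \<gamma> x \<in> edges T"
    unfolding act using e paths_mult[OF assms(1) p] by (rule tree_edgeI)
  show "ini T (tree_action A \<gamma> x) = tree_action A \<gamma> (ini T x)"
    unfolding act unfolding x tree_ini[OF e P.m_closed[OF gc pc]] tree_ini[OF e pc]
    by (rule tree_action_coset[OF gc pc vertex_subgroup_carrier[OF ini_closed[OF e]], symmetric])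
  show "ter T (tree_action A \<gamma> x) = tree_action A \<gamma> (ter T x)"
    unfolding act unfolding x tree_ter[OF e P.m_closed[OF gc pc]] tree_ter[OF e pc]
      P.m_assoc[OF gc pc tc]
    by (rule tree_action_coset[OF gc P.m_closed[OF pc tc] vertex_subgroup_carrier[OF ter_closed[OF e]], symmetric])
qed

lemma tree_action_path:
  assumes "\<gamma> \<in> paths_between A a a"
  shows "edge_path T x es y \<Longrightarrow>
    edge_path T (tree_action A \<gamma> x) (map (tree_action A \<gamma>) es) (tree_action A \<gamma> y)"
proof (induction es arbitrary: x)
  case Nil
  then show ?case using tree_action_vert[OF assms, of x] by auto
next
  case (Cons e es)
  then show ?case using tree_action_edge[OF assms, of e] by simp
qed

lemma tree_action_dist:
  assumes \<gamma>: "\<gamma> \<in> paths_between A a a" and xy: "x \<in> verts T" "y \<in> verts T"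
  shows "graph_dist T (tree_action A \<gamma> x) (tree_action A \<gamma> y) = graph_dist T x y"
proof (rule antisym)
  have le: "graph_dist T (tree_action A \<delta> x) (tree_action A \<delta> y) \<le> graph_dist T x y"
    if \<delta>: "\<delta> \<in> paths_between A a a" and xy: "x \<in> verts T" "y \<in> verts T" for \<delta> x y
  proof -
    obtain es where "edge_path T x es y" "graph_dist T x y = real (length es)"
      using graph_dist_attained[OF connected_tree xy] by blast
    then show ?thesis using graph_dist_le[OF tree_action_path[OF \<delta>]] by fastforce
  qed
  show "graph_dist T (tree_action A \<gamma> x) (tree_action A \<gamma> y) \<le> graph_dist T x y"
    using assms by (rule le)
  have undo: "tree_action A (inv\<^bsub>path_group A\<^esub> \<gamma>) (tree_action A \<gamma> z) = z" if "z \<in> verts T" for z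
    using tree_action_mult[OF paths_inv[OF \<gamma>] \<gamma> that] tree_action_one[OF that] paths_closed[OF \<gamma>]
    by simp
  show "graph_dist T x y \<le> graph_dist T (tree_action A \<gamma> x) (tree_action A \<gamma> y)"
    using le[OF paths_inv[OF \<gamma>] tree_action_vert[OF \<gamma> xy(1)] tree_action_vert[OF \<gamma> xy(2)]]
    unfolding undo[OF xy(1)] undo[OF xy(2)] .
qed

text \<open>The base vertex is the coset of the identity, so an element fixes it exactly when it lies
  in the vertex group.\<close>

lemma stabiliser_base:
  assumes "\<gamma> \<in> paths_between A a a"
  shows "tree_action A \<gamma> base = base \<longleftrightarrow> \<gamma> \<in> vertex_subgroup A a"
proof
  note V = vertex_subgroup_subgroup[OF base_vert]
  assume "tree_action A \<gamma> base = base"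
  then have "\<gamma> <#\<^bsub>path_group A\<^esub> vertex_subgroup A a = vertex_subgroup A a"
    by (simp add: tree_action_def)
  moreover have "\<gamma> \<otimes>\<^bsub>path_group A\<^esub> \<one>\<^bsub>path_group A\<^esub> \<in> \<gamma> <#\<^bsub>path_group A\<^esub> vertex_subgroup A a"
    unfolding l_coset_def using subgroup.one_closed[OF V] by blast
  ultimately show "\<gamma> \<in> vertex_subgroup A a" using paths_closed[OF assms] by simp
next
  assume "\<gamma> \<in> vertex_subgroup A a"
  then show "tree_action A \<gamma> base = base"
    using P.coset_join3[OF paths_closed[OF assms] vertex_subgroup_subgroup[OF base_vert]]
    by (simp add: tree_action_def)
qed

text \<open>From a coset at \<open>v\<close> one reaches a coset at \<open>a\<close> by lifting an edge path of the connected graph \<open>A\<close>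
  from \<open>v\<close> to \<open>a\<close>; fixing one such path for each of the finitely many vertices bounds its length. The
  cosets at \<open>a\<close> are the orbit of the base vertex.\<close>

lemma tree_cobounded:
  assumes "finite_graph A"
  shows "\<exists>D. \<forall>x\<in>verts T. \<exists>\<gamma>\<in>paths_between A a a. graph_dist T (tree_action A \<gamma> base) x \<le> D"
proof -
  have "\<exists>w. word_along A v w a" if "v \<in> verts A" for v
  proof -
    have "word_along A v (map ELetter es) u" if "edge_path A v es u" for es v u
      using that by (induction es arbitrary: v) auto
    then show ?thesis using connected that base_vert unfolding connected_graph_def by blast
  qed
  then obtain w where w: "\<And>v. v \<in> verts A \<Longrightarrow> word_along A v (w v) a" by metis
  define D where "D = Max ((\<lambda>v. length (w v)) ` verts A)"
  have D: "length (w v) \<le> D" if "v \<in> verts A" for v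
    unfolding D_def using assms that by (intro Max_ge) (auto simp: finite_graph_def)
  show ?thesis
  proof (intro exI[of _ "real D"] ballI)
    fix x assume x: "x \<in> verts T"
    obtain v p where v: "v \<in> verts A" "p \<in> paths_between A a v"
      "x = (v, p <#\<^bsub>path_group A\<^esub> vertex_subgroup A v)" using x by (rule tree_vertE)
    define \<gamma> where "\<gamma> = p \<otimes>\<^bsub>path_group A\<^esub> path_class A (w v)"
    have "path_class A (w v) \<in> paths_between A v a"
      using w[OF v(1)] by (simp add: paths_between_def)
    with v(2) have \<gamma>: "\<gamma> \<in> paths_between A a a" unfolding \<gamma>_def by (rule paths_mult)
    have act: "tree_action A \<gamma> base = (a, \<gamma> <#\<^bsub>path_group A\<^esub> vertex_subgroup A a)"
      by (simp add: tree_action_def)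
    obtain es where "edge_path T x es (tree_action A \<gamma> base)" "length es \<le> length (w v)"
      using tree_path_of_word[OF w[OF v(1)] v(2), folded \<gamma>_def] unfolding act v(3) by blast
    then have "graph_dist T x (tree_action A \<gamma> base) \<le> real D"
      using graph_dist_le[of T x es] D[OF v(1)] by fastforce
    then have "graph_dist T (tree_action A \<gamma> base) x \<le> real D"
      using graph_dist_sym[OF serre_tree connected_tree x tree_action_vert[OF \<gamma> base_in_tree]] by simp
    with \<gamma> show "\<exists>\<gamma>\<in>paths_between A a a. graph_dist T (tree_action A \<gamma> base) x \<le> real D" by blast
  qed
qed

text \<open>The transport along the trivial path element.\<close>

lemma vertex_subgroup_local: "vertex_subgroup A a \<in> local_subgroups A a"
proof -
  have "conjugate (path_group A) \<one>\<^bsub>path_group A\<^esub> (vertex_subgroup A a) = vertex_subgroup A a"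
    unfolding conjugate_def using vertex_subgroup_carrier[OF base_vert] by (auto simp: subset_iff image_iff)
  then show ?thesis
    unfolding local_subgroups_def using base_vert paths_one[OF base_vert] by blast
qed

end

section \<open>Products with a CAT(0) space\<close>

lemma l2_product_dist_triangle:
  assumes "d x z \<le> d x y + d y z" "d' x' z' \<le> d' x' y' + d' y' z'" "0 \<le> d x z" "0 \<le> d' x' z'"
  shows "l2_product_dist d d' (x, x') (z, z') \<le>
    l2_product_dist d d' (x, x') (y, y') + l2_product_dist d d' (y, y') (z, z')"
proof -
  have "sqrt ((d x z)\<^sup>2 + (d' x' z')\<^sup>2) \<le> sqrt ((d x y + d y z)\<^sup>2 + (d' x' y' + d' y' z')\<^sup>2)"
    using assms by (intro real_sqrt_le_mono add_mono power_mono)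
  also have "\<dots> \<le> sqrt ((d x y)\<^sup>2 + (d' x' y')\<^sup>2) + sqrt ((d y z)\<^sup>2 + (d' y' z')\<^sup>2)"
    by (rule real_sqrt_sum_squares_triangle_ineq)
  finally show ?thesis by (simp add: l2_product_dist_def)
qed

lemma l2_product_dist_ge:
  "d x y \<le> l2_product_dist d d' (x, x') (y, y')" "d' x' y' \<le> l2_product_dist d d' (x, x') (y, y')"
  by (simp_all add: l2_product_dist_def)

lemma l2_product_dist_le:
  "0 \<le> d x y \<Longrightarrow> 0 \<le> d' x' y' \<Longrightarrow> l2_product_dist d d' (x, x') (y, y') \<le> d x y + d' x' y'"
  by (simp add: l2_product_dist_def sqrt_sum_squares_le_sum)

lemma relpow_mono_map:
  assumes "(x, y) \<in> R ^^ n" "\<And>p q. (p, q) \<in> R \<Longrightarrow> (f p, f q) \<in> S"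
  shows "(f x, f y) \<in> S ^^ n"
  using assms(1)
proof (induction n arbitrary: y)
  case (Suc n)
  then obtain z where "(x, z) \<in> R ^^ n" "(z, y) \<in> R" by auto
  then show ?case using Suc.IH assms(2) by (auto intro: relpow_Suc_I)
qed simp

text \<open>The chain consists of the points at integer times on a geodesic; cutting the time off at its
  length makes the last, possibly shorter, step end at \<open>y\<close>.\<close>

lemma CAT0_chain:
  fixes x y :: "'x::metric_space"
  assumes "CAT0 TYPE('x)"
  shows "\<exists>n. (x, y) \<in> {(p, q). dist p q \<le> 1} ^^ n \<and> real n \<le> dist x y + 1"
proof -
  obtain c where c: "c 0 = x" "c (dist x y) = y"
    "\<And>s t. s \<in> {0..dist x y} \<Longrightarrow> t \<in> {0..dist x y} \<Longrightarrow> dist (c s) (c t) = \<bar>s - t\<bar>"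
    using assms unfolding CAT0_def geodesic_segment_def by metis
  define n where "n = nat \<lceil>dist x y\<rceil>"
  have "real n = of_int \<lceil>dist x y\<rceil>" 
    unfolding n_def using zero_le_dist[of x y] by (intro of_nat_nat) linarith
  then have n: "dist x y \<le> real n" "real n \<le> dist x y + 1" by linarith+
  define f where "f i = c (min (dist x y) (real i))" for i
  have "f 0 = x" "f n = y" using c(1,2) n by (simp_all add: f_def min_absorb2 min_absorb1)
  moreover have "dist (f i) (f (Suc i)) \<le> 1" for i
    unfolding f_def by (subst c(3)) (auto simp: min_def)
  ultimately have "(x, y) \<in> {(p, q). dist p q \<le> 1} ^^ n"
    unfolding relpow_fun_conv by (intro exI[of _ f]) auto
  with n(2) show ?thesis by blast
qed

text \<open>The chain moves first along a geodesic in \<open>X\<close> and then along a shortest edge path in the graph.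
  Each of the two lengths is at most the distance in the product, which accounts for the factor 2.\<close>

lemma product_chain:
  fixes x y :: "'x::metric_space"
  assumes "CAT0 TYPE('x)" "serre_graph T" "connected_graph T" "v \<in> verts T" "w \<in> verts T"
  shows "\<exists>n. ((x, v), (y, w)) \<in> {(p, q). p \<in> UNIV \<times> verts T \<and> q \<in> UNIV \<times> verts T \<and>
      l2_product_dist dist (graph_dist T) p q \<le> 1} ^^ n \<and>
    real n \<le> 2 * l2_product_dist dist (graph_dist T) (x, v) (y, w) + 1"
proof -
  let ?d = "l2_product_dist dist (graph_dist T) :: 'x \<times> _ \<Rightarrow> _"
  let ?R = "{(p, q). p \<in> UNIV \<times> verts T \<and> q \<in> UNIV \<times> verts T \<and> ?d p q \<le> 1}"
  obtain m where m: "(x, y) \<in> {(p, q). dist p q \<le> 1} ^^ m" "real m \<le> dist x y + 1"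
    using CAT0_chain[OF assms(1)] by blast
  obtain es where es: "edge_path T v es w" "graph_dist T v w = real (length es)"
    using graph_dist_attained[OF assms(3-5)] by blast
  have "((x, v), (y, v)) \<in> ?R ^^ m"
    using m(1)
    by (rule relpow_mono_map) (use assms(4) in \<open>auto simp: l2_product_dist_def graph_dist_self\<close>)
  moreover have "((y, v), (y, w)) \<in> ?R ^^ length es"
    using graph_dist_chain[OF assms(2) es(1)]
    by (rule relpow_mono_map) (auto simp: l2_product_dist_def graph_dist_nonneg)
  ultimately have "((x, v), (y, w)) \<in> ?R ^^ (m + length es)" unfolding relpow_add by blast
  moreover have "real (m + length es) \<le> 2 * ?d (x, v) (y, w) + 1"
    using m(2) es(2) l2_product_dist_ge[of dist x y "graph_dist T" v w]
      l2_product_dist_ge(2)[of "graph_dist T" v w dist x y] by simp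
  ultimately show ?thesis by blast
qed

lemma near_vertex_of_realisation:
  assumes "serre_graph T" "connected_graph T" "z \<in> realisation T"
  shows "\<exists>v\<in>verts T. \<forall>w\<in>verts T. 0 \<le> realisation_dist T (Inl w) z \<and>
    realisation_dist T (Inl w) z \<le> graph_dist T w v + 1"
proof (cases z)
  case (Inl v)
  then show ?thesis using assms(3) by (intro bexI[of _ v]) (auto simp: realisation_def graph_dist_nonneg)
next
  case (Inr et)
  obtain e t where et: "et = (e, t)" by (cases et)
  have e: "e \<in> edges T" "0 \<le> t" "t \<le> 1" using assms(3) by (auto simp: realisation_def Inr et)
  then have "ini T e \<in> verts T" using assms(1) by (simp add: serre_graph_def)
  moreover have "0 \<le> realisation_dist T (Inl w) z \<and>
      realisation_dist T (Inl w) z \<le> graph_dist T w (ini T e) + 1" for w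
    using e graph_dist_nonneg[of T w "ini T e"] graph_dist_nonneg[of T w "ter T e"]
    by (auto simp: Inr et min_def)
  ultimately show ?thesis by blast
qed

lemma group_quasi_isometric_to_realisation:
  fixes G :: "('g, 'm) monoid_scheme" and T :: "('v, 'e, 'z) sgraph_scheme"
  assumes T: "serre_graph T" "connected_graph T"
    and G: "group_quasi_isometric_to G (UNIV \<times> verts T)
      (l2_product_dist (dist :: 'x::metric_space \<Rightarrow> 'x \<Rightarrow> real) (graph_dist T))"
  shows "group_quasi_isometric_to G (UNIV \<times> realisation T)
      (l2_product_dist (dist :: 'x \<Rightarrow> 'x \<Rightarrow> real) (realisation_dist T))"
proof (rule group_quasi_isometric_to_thickening[OF G, where f = "\<lambda>(x, v). (x, Inl v)" and r = 1])
  show "(\<lambda>(x, v). (x, Inl v)) ` (UNIV \<times> verts T) \<subseteq> UNIV \<times> realisation T"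
    by (auto simp: realisation_def)
  fix z :: "'x \<times> ('v + 'e \<times> real)" assume "z \<in> UNIV \<times> realisation T"
  then obtain x q where z: "z = (x, q)" "q \<in> realisation T" by auto
  obtain v where v: "v \<in> verts T" "\<And>w. w \<in> verts T \<Longrightarrow> 0 \<le> realisation_dist T (Inl w) q \<and>
      realisation_dist T (Inl w) q \<le> graph_dist T w v + 1"
    using near_vertex_of_realisation[OF T z(2)] by blast
  show "\<exists>y\<in>UNIV \<times> verts T. \<forall>p\<in>UNIV \<times> verts T.
      l2_product_dist dist (realisation_dist T) ((\<lambda>(x, v). (x, Inl v)) p) z \<le>
        l2_product_dist dist (graph_dist T) p y + 1"
  proof (intro bexI[of _ "(x, v)"] ballI)
    fix p :: "'x \<times> 'v" assume "p \<in> UNIV \<times> verts T"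
    then obtain y w where p: "p = (y, w)" "w \<in> verts T" by auto
    have "sqrt ((dist y x)\<^sup>2 + (realisation_dist T (Inl w) q)\<^sup>2) \<le>
        sqrt ((dist y x + 0)\<^sup>2 + (graph_dist T w v + 1)\<^sup>2)"
      using v(2)[OF p(2)] by (intro real_sqrt_le_mono add_mono power_mono) auto
    also have "\<dots> \<le> sqrt ((dist y x)\<^sup>2 + (graph_dist T w v)\<^sup>2) + sqrt (0\<^sup>2 + 1\<^sup>2)"
      by (rule real_sqrt_sum_squares_triangle_ineq)
    finally show "l2_product_dist dist (realisation_dist T) ((\<lambda>(x, v). (x, Inl v)) p) z \<le>
        l2_product_dist dist (graph_dist T) p (x, v) + 1"
      by (simp add: p z l2_product_dist_def)
  qed (use v in auto)
qed (auto simp: l2_product_dist_def)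

section \<open>The geometric action of the fundamental group\<close>

lemma hom_finite_fibres:
  assumes "group B" "group H" "\<phi> \<in> hom B H" "finite (kernel B H \<phi>)"
  shows "finite {b \<in> carrier B. \<phi> b = h}"
proof (cases "\<exists>c\<in>carrier B. \<phi> c = h")
  case True
  then obtain c where c: "c \<in> carrier B" "\<phi> c = h" by blast
  interpret group_hom B H \<phi> using assms by (intro group_hom.intro group_hom_axioms.intro)
  have "{b \<in> carrier B. \<phi> b = h} \<subseteq> (\<lambda>k. c \<otimes>\<^bsub>B\<^esub> k) ` kernel B H \<phi>"
  proof
    fix b assume "b \<in> {b \<in> carrier B. \<phi> b = h}"
    then have b: "b \<in> carrier B" "\<phi> b = h" by auto
    have "inv\<^bsub>B\<^esub> c \<otimes>\<^bsub>B\<^esub> b \<in> kernel B H \<phi>" using b c by (auto simp: kernel_def)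
    moreover have "b = c \<otimes>\<^bsub>B\<^esub> (inv\<^bsub>B\<^esub> c \<otimes>\<^bsub>B\<^esub> b)" using b c by (simp add: G.m_assoc[symmetric])
    ultimately show "b \<in> (\<lambda>k. c \<otimes>\<^bsub>B\<^esub> k) ` kernel B H \<phi>" by blast
  qed
  then show ?thesis using assms(4) finite_subset by blast
next
  case False
  then have "{b \<in> carrier B. \<phi> b = h} = {}" by blast
  then show ?thesis by (simp only: finite.emptyI)
qed

lemma covirtual_lattice_proper:
  fixes x\<^sub>0 :: "'x::heine_borel"
  assumes B: "group B" and \<phi>: "covirtually_lattice isometry_group isometry_topology B \<phi>"
  shows "finite {b \<in> carrier B. dist (\<phi> b x\<^sub>0) x\<^sub>0 \<le> r}"
proof -
  let ?L = "{h \<in> \<phi> ` carrier B. dist (h x\<^sub>0) x\<^sub>0 \<le> r}"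
  have "finite ?L"
    using \<phi> by (intro discrete_isometries_proper) (auto simp: covirtually_lattice_def lattice_in_def)
  moreover have "finite {b \<in> carrier B. \<phi> b = h}" for h
    using \<phi> B group_isometry_group by (intro hom_finite_fibres) (auto simp: covirtually_lattice_def)
  ultimately have "finite (\<Union>h\<in>?L. {b \<in> carrier B. \<phi> b = h})" by (rule finite_UN_I)
  then show ?thesis by (rule rev_finite_subset) auto
qed

context pointed_gog
begin

text \<open>The stabiliser of the base vertex is the vertex group at \<open>a\<close>. Elements that move the base
  vertex to a given vertex form one of its cosets, and there properness of the vertex group on
  \<open>X\<close> applies; local finiteness leaves only finitely many vertices.\<close>

lemma product_action_proper:
  fixes \<psi> :: "('v, 'e, 'a, 'b, 'x::heine_borel \<Rightarrow> 'x) gog_morphism" and x\<^sub>0 :: 'x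
  assumes \<psi>: "morphism_to_group A isometry_group \<psi>"
    and lf: "locally_finite_graph T"
    and lat: "covirtually_lattice isometry_group isometry_topology
      ((fundamental_group A a)\<lparr>carrier := vertex_subgroup A a\<rparr>) (induced_hom A isometry_group \<psi>)"
  shows "finite {\<gamma> \<in> paths_between A a a. dist x\<^sub>0 (induced_hom A isometry_group \<psi> \<gamma> x\<^sub>0) \<le> r \<and>
    graph_dist T base (tree_action A \<gamma> base) \<le> r}" (is "finite ?F")
proof -
  let ?\<phi> = "induced_hom A isometry_group \<psi>"
  have hom: "?\<phi> \<in> hom (path_group A) isometry_group"
    by (rule induced_hom_hom[OF group_isometry_group \<psi>])
  interpret \<phi>: group_hom "path_group A" isometry_group ?\<phi>
    by (intro group_hom.intro group_hom_axioms.intro group_path_group group_isometry_group hom)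
  note V = vertex_subgroup_subgroup[OF base_vert]
  have "group ((fundamental_group A a)\<lparr>carrier := vertex_subgroup A a\<rparr>)"
    using subgroup.subgroup_is_group[OF V group_path_group] by (simp add: fundamental_group_def)
  from covirtual_lattice_proper[OF this lat, of x\<^sub>0]
  have finV: "finite {b \<in> vertex_subgroup A a. dist (?\<phi> b x\<^sub>0) x\<^sub>0 \<le> s}" for s by simp
  have "finite {\<gamma> \<in> ?F. tree_action A \<gamma> base = w}" for w
  proof (cases "\<exists>\<delta>\<in>?F. tree_action A \<delta> base = w")
    case True
    then obtain \<delta> where \<delta>: "\<delta> \<in> ?F" "tree_action A \<delta> base = w" by blast
    then have \<delta>p: "\<delta> \<in> paths_between A a a" by blast
    note \<delta>c = paths_closed[OF \<delta>p]
    have "{\<gamma> \<in> ?F. tree_action A \<gamma> base = w} \<subseteq>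
      (\<lambda>b. \<delta> \<otimes>\<^bsub>path_group A\<^esub> b) ` {b \<in> vertex_subgroup A a. dist (?\<phi> b x\<^sub>0) x\<^sub>0 \<le> 2 * r}"
    proof
      fix \<gamma> assume "\<gamma> \<in> {\<gamma> \<in> ?F. tree_action A \<gamma> base = w}"
      then have \<gamma>: "\<gamma> \<in> paths_between A a a" "tree_action A \<gamma> base = w"
        "dist x\<^sub>0 (?\<phi> \<gamma> x\<^sub>0) \<le> r" by auto
      note \<gamma>c = paths_closed[OF \<gamma>(1)]
      let ?b = "inv\<^bsub>path_group A\<^esub> \<delta> \<otimes>\<^bsub>path_group A\<^esub> \<gamma>"
      have b: "?b \<in> paths_between A a a" using paths_mult[OF paths_inv[OF \<delta>p] \<gamma>(1)] .
      have "tree_action A ?b base = tree_action A (inv\<^bsub>path_group A\<^esub> \<delta>) (tree_action A \<delta> base)"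
        using tree_action_mult[OF paths_inv[OF \<delta>p] \<gamma>(1) base_in_tree] \<gamma>(2) \<delta>(2) by simp
      also have "\<dots> = base"
        using tree_action_mult[OF paths_inv[OF \<delta>p] \<delta>p base_in_tree] tree_action_one[OF base_in_tree] \<delta>c
        by simp
      finally have bV: "?b \<in> vertex_subgroup A a" using stabiliser_base[OF b] by blast
      have mult: "\<delta> \<otimes>\<^bsub>path_group A\<^esub> ?b = \<gamma>" using \<delta>c \<gamma>c by (simp add: P.m_assoc[symmetric])
      have "?\<phi> \<gamma> = ?\<phi> \<delta> \<circ> ?\<phi> ?b"
        using \<phi>.hom_mult[OF \<delta>c paths_closed[OF b]] unfolding mult by simp
      then have "dist (?\<phi> ?b x\<^sub>0) x\<^sub>0 = dist (?\<phi> \<gamma> x\<^sub>0) (?\<phi> \<delta> x\<^sub>0)"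
        using isometry_groupD(2)[OF \<phi>.hom_closed[OF \<delta>c], of "?\<phi> ?b x\<^sub>0" x\<^sub>0] by simp
      also have "\<dots> \<le> dist x\<^sub>0 (?\<phi> \<gamma> x\<^sub>0) + dist x\<^sub>0 (?\<phi> \<delta> x\<^sub>0)"
        using dist_triangle[of "?\<phi> \<gamma> x\<^sub>0" "?\<phi> \<delta> x\<^sub>0" x\<^sub>0] by (simp add: dist_commute)
      also have "\<dots> \<le> 2 * r" using \<gamma>(3) \<delta>(1) by simp
      finally show "\<gamma> \<in> (\<lambda>b. \<delta> \<otimes>\<^bsub>path_group A\<^esub> b) `
          {b \<in> vertex_subgroup A a. dist (?\<phi> b x\<^sub>0) x\<^sub>0 \<le> 2 * r}"
        using bV mult by (intro image_eqI[of _ _ ?b]) auto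
    qed
    then show ?thesis by (rule finite_subset) (intro finite_imageI finV)
  next
    case False
    then have "{\<gamma> \<in> ?F. tree_action A \<gamma> base = w} = {}" by blast
    then show ?thesis by (simp only: finite.emptyI)
  qed
  then have "finite (\<Union>w\<in>{w \<in> verts T. graph_dist T base w \<le> r}. {\<gamma> \<in> ?F. tree_action A \<gamma> base = w})"
    by (intro finite_UN_I finite_graph_ball[OF serre_tree connected_tree lf base_in_tree])
  then show ?thesis
  proof (rule rev_finite_subset, intro subsetI)
    fix \<gamma> assume \<gamma>: "\<gamma> \<in> ?F"
    then have "tree_action A \<gamma> base \<in> verts T" using tree_action_vert base_in_tree by simp
    then have "tree_action A \<gamma> base \<in> {w \<in> verts T. graph_dist T base w \<le> r}" using \<gamma> by simp
    then show "\<gamma> \<in> (\<Union>w\<in>{w \<in> verts T. graph_dist T base w \<le> r}. {\<gamma> \<in> ?F. tree_action A \<gamma> base = w})"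
      by (rule UN_I) (use \<gamma> in simp)
  qed
qed

text \<open>An element \<open>\<delta>\<close> first brings the base vertex close to \<open>w\<close>. Multiplying it on the right by an element
  of the stabiliser of the base vertex keeps the tree coordinate and brings the \<open>X\<close> coordinate
  close to \<open>x\<close>, since the stabiliser has coarsely dense orbits in \<open>X\<close>.\<close>

lemma product_action_cobounded:
  fixes \<psi> :: "('v, 'e, 'a, 'b, 'x::metric_space \<Rightarrow> 'x) gog_morphism" and x\<^sub>0 :: 'x
  assumes \<psi>: "morphism_to_group A isometry_group \<psi>"
    and "finite_graph A"
    and X: "cocompact_isometry_group TYPE('x)"
    and lat: "uniform_lattice_in isometry_group isometry_topology
      (induced_hom A isometry_group \<psi> ` vertex_subgroup A a)"
  obtains R where "\<And>x w. w \<in> verts T \<Longrightarrow> \<exists>\<gamma>\<in>paths_between A a a.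
    dist (induced_hom A isometry_group \<psi> \<gamma> x\<^sub>0) x \<le> R \<and> graph_dist T (tree_action A \<gamma> base) w \<le> R"
proof -
  let ?\<phi> = "induced_hom A isometry_group \<psi>"
  have hom: "?\<phi> \<in> hom (path_group A) isometry_group"
    by (rule induced_hom_hom[OF group_isometry_group \<psi>])
  interpret \<phi>: group_hom "path_group A" isometry_group ?\<phi>
    by (intro group_hom.intro group_hom_axioms.intro group_path_group group_isometry_group hom)
  obtain D where D: "\<And>w. w \<in> verts T \<Longrightarrow>
      \<exists>\<gamma>\<in>paths_between A a a. graph_dist T (tree_action A \<gamma> base) w \<le> D"
    using tree_cobounded[OF assms(2)] by blast
  obtain R where R: "\<And>x::'x. \<exists>h\<in>?\<phi> ` vertex_subgroup A a. dist (h x\<^sub>0) x \<le> R"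
    using uniform_lattice_cobounded[OF lat X] by metis
  show ?thesis
  proof (rule that[of "max D R"])
    fix x :: 'x and w assume "w \<in> verts T"
    then obtain \<delta> where \<delta>: "\<delta> \<in> paths_between A a a" "graph_dist T (tree_action A \<delta> base) w \<le> D"
      using D by blast
    note \<delta>c = paths_closed[OF \<delta>(1)]
    let ?y = "(inv\<^bsub>isometry_group\<^esub> (?\<phi> \<delta>)) x"
    obtain b where b: "b \<in> vertex_subgroup A a" "dist (?\<phi> b x\<^sub>0) ?y \<le> R"
      using R[of ?y] by blast
    have bp: "b \<in> paths_between A a a" using b(1) vertex_subgroup_paths[OF base_vert] by blast
    have "tree_action A (\<delta> \<otimes>\<^bsub>path_group A\<^esub> b) base = tree_action A \<delta> base"
      using tree_action_mult[OF \<delta>(1) bp base_in_tree] stabiliser_base[OF bp] b(1) by simp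
    moreover have "dist (?\<phi> (\<delta> \<otimes>\<^bsub>path_group A\<^esub> b) x\<^sub>0) x = dist (?\<phi> b x\<^sub>0) ?y"
      using isometry_groupD(2)[OF \<phi>.hom_closed[OF \<delta>c], of "?\<phi> b x\<^sub>0" ?y]
        isometry_inv_apply(2)[OF \<phi>.hom_closed[OF \<delta>c]] \<phi>.hom_mult[OF \<delta>c paths_closed[OF bp]]
      by simp
    ultimately show "\<exists>\<gamma>\<in>paths_between A a a. dist (?\<phi> \<gamma> x\<^sub>0) x \<le> max D R \<and>
        graph_dist T (tree_action A \<gamma> base) w \<le> max D R"
      using b \<delta>(2) paths_mult[OF \<delta>(1) bp]
      by (intro bexI[of _ "\<delta> \<otimes>\<^bsub>path_group A\<^esub> b"]) auto
  qed
qed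

lemma product_action_geometric:
  fixes \<psi> :: "('v, 'e, 'a, 'b, 'x::heine_borel \<Rightarrow> 'x) gog_morphism" and x\<^sub>0 :: 'x
  assumes X: "CAT0 TYPE('x)" "cocompact_isometry_group TYPE('x)"
    and \<psi>: "morphism_to_group A isometry_group \<psi>"
    and A: "finite_graph A" "locally_finite_graph T"
    and lat: "covirtually_uniform_lattice isometry_group isometry_topology
      ((fundamental_group A a)\<lparr>carrier := vertex_subgroup A a\<rparr>) (induced_hom A isometry_group \<psi>)"
  shows "geometric_action (fundamental_group A a) (UNIV \<times> verts T)
    (l2_product_dist dist (graph_dist T))
    (\<lambda>\<gamma> (x, w). (induced_hom A isometry_group \<psi> \<gamma> x, tree_action A \<gamma> w)) (x\<^sub>0, base)"
proof -
  let ?\<phi> = "induced_hom A isometry_group \<psi>"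
  have hom: "?\<phi> \<in> hom (path_group A) isometry_group"
    by (rule induced_hom_hom[OF group_isometry_group \<psi>])
  interpret \<phi>: group_hom "path_group A" isometry_group ?\<phi>
    by (intro group_hom.intro group_hom_axioms.intro group_path_group group_isometry_group hom)
  have clat: "covirtually_lattice isometry_group isometry_topology
      ((fundamental_group A a)\<lparr>carrier := vertex_subgroup A a\<rparr>) ?\<phi>"
    and ulat: "uniform_lattice_in isometry_group isometry_topology (?\<phi> ` vertex_subgroup A a)"
    using lat by (auto simp: covirtually_lattice_def covirtually_uniform_lattice_def uniform_lattice_in_def)
  let ?Y = "UNIV \<times> verts T :: ('x \<times> _) set" and ?d = "l2_product_dist dist (graph_dist T) :: 'x \<times> _ \<Rightarrow> _"
  let ?act = "\<lambda>\<gamma> (x, w). (?\<phi> \<gamma> x, tree_action A \<gamma> w)" and ?y = "(x\<^sub>0, base)"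
  show ?thesis
  proof (intro geometric_action.intro geometric_action_axioms.intro)
    show "group (fundamental_group A a)" by (rule group_fundamental_group[OF base_vert])
    show "?y \<in> ?Y" using base_in_tree by simp
    fix r
    show "finite {\<gamma> \<in> carrier (fundamental_group A a). ?d ?y (?act \<gamma> ?y) \<le> r}"
    proof (rule finite_subset[OF _ product_action_proper[OF \<psi> A(2) clat, of x\<^sub>0 r]])
      show "{\<gamma> \<in> carrier (fundamental_group A a). ?d ?y (?act \<gamma> ?y) \<le> r} \<subseteq>
        {\<gamma> \<in> paths_between A a a. dist x\<^sub>0 (?\<phi> \<gamma> x\<^sub>0) \<le> r \<and> graph_dist T base (tree_action A \<gamma> base) \<le> r}"
        by (auto simp: fundamental_group_simps
            intro: order_trans[OF l2_product_dist_ge(1)] order_trans[OF l2_product_dist_ge(2)])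
    qed
  next
    obtain R where R: "\<And>x w. w \<in> verts T \<Longrightarrow> \<exists>\<gamma>\<in>paths_between A a a.
        dist (?\<phi> \<gamma> x\<^sub>0) x \<le> R \<and> graph_dist T (tree_action A \<gamma> base) w \<le> R"
      by (rule product_action_cobounded[OF \<psi> A(1) X(2) ulat], rule that)
    show "\<exists>R. \<forall>y\<in>?Y. \<exists>\<gamma>\<in>carrier (fundamental_group A a). ?d (?act \<gamma> ?y) y \<le> R"
    proof (intro exI[of _ "R + R"] ballI)
      fix y :: "'x \<times> _" assume "y \<in> ?Y"
      then obtain x w where y: "y = (x, w)" "w \<in> verts T" by auto
      obtain \<gamma> where \<gamma>: "\<gamma> \<in> paths_between A a a" "dist (?\<phi> \<gamma> x\<^sub>0) x \<le> R"
          "graph_dist T (tree_action A \<gamma> base) w \<le> R" using R[OF y(2)] by blast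
      have "?d (?act \<gamma> ?y) y \<le> R + R"
        using l2_product_dist_le[of dist "?\<phi> \<gamma> x\<^sub>0" x "graph_dist T" "tree_action A \<gamma> base" w] \<gamma>(2,3)
        by (simp add: y(1) graph_dist_nonneg)
      with \<gamma>(1) show "\<exists>\<gamma>\<in>carrier (fundamental_group A a). ?d (?act \<gamma> ?y) y \<le> R + R"
        by (auto simp: fundamental_group_simps)
    qed
  next
    show "\<exists>c k. \<forall>y\<in>?Y. \<forall>z\<in>?Y. \<exists>n. (y, z) \<in> {(p, q). p \<in> ?Y \<and> q \<in> ?Y \<and> ?d p q \<le> 1} ^^ n \<and>
        real n \<le> c * ?d y z + k"
    proof (rule exI[of _ 2], rule exI[of _ 1], intro ballI)
      fix y z :: "'x \<times> _" assume "y \<in> ?Y" "z \<in> ?Y"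
      then show "\<exists>n. (y, z) \<in> {(p, q). p \<in> ?Y \<and> q \<in> ?Y \<and> ?d p q \<le> 1} ^^ n \<and>
          real n \<le> 2 * ?d y z + 1"
        using product_chain[OF X(1) serre_tree connected_tree, of "snd y" "snd z" "fst y" "fst z"]
        by (simp add: mem_Times_iff)
    qed
  next
    fix g y assume "g \<in> carrier (fundamental_group A a)" "y \<in> ?Y"
    then show "?act g y \<in> ?Y" by (auto simp: fundamental_group_simps tree_action_vert)
  next
    fix y assume "y \<in> ?Y"
    then show "?act \<one>\<^bsub>fundamental_group A a\<^esub> y = y"
      by (auto simp: fundamental_group_simps tree_action_one)
  next
    fix g h y assume "g \<in> carrier (fundamental_group A a)" "h \<in> carrier (fundamental_group A a)" "y \<in> ?Y"
    then show "?act (g \<otimes>\<^bsub>fundamental_group A a\<^esub> h) y = ?act g (?act h y)"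
      by (auto simp: fundamental_group_simps tree_action_mult paths_closed)
  next
    fix g y z assume "g \<in> carrier (fundamental_group A a)" "y \<in> ?Y" "z \<in> ?Y"
    then show "?d (?act g y) (?act g z) = ?d y z"
      by (auto simp: fundamental_group_simps tree_action_dist l2_product_dist_def
          isometry_groupD(2)[OF \<phi>.hom_closed[OF paths_closed]])
  next
    fix y assume "y \<in> ?Y"
    then show "?d y y = 0" by (auto simp: l2_product_dist_def graph_dist_self)
  next
    fix y z assume "y \<in> ?Y" "z \<in> ?Y"
    then show "?d y z = ?d z y"
      by (auto simp: l2_product_dist_def dist_commute graph_dist_sym[OF serre_tree connected_tree])
  next
    fix x y z assume "x \<in> ?Y" "y \<in> ?Y" "z \<in> ?Y"
    then show "?d x z \<le> ?d x y + ?d y z"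
      by (auto intro!: l2_product_dist_triangle dist_triangle graph_dist_nonneg
          graph_dist_triangle[OF serre_tree connected_tree])
  qed
qed

end

theorem corollary3p3:
  fixes A :: "('v, 'e, 'a, 'b) graph_of_groups"
    and \<psi> :: "('v, 'e, 'a, 'b, 'x::heine_borel \<Rightarrow> 'x) gog_morphism"
    and a :: 'v
  assumes "CAT0 TYPE('x)"
    and "finite_dimensional_tits_boundary TYPE('x)"
    and "cocompact_isometry_group TYPE('x)"
    and "\<exists>L. uniform_lattice_in (isometry_group :: ('x \<Rightarrow> 'x) monoid) isometry_topology L"
    and "graph_of_lattices A isometry_group isometry_topology \<psi>"
    and "a \<in> verts A"
    and "locally_finite_graph (bass_serre_tree A a)"
    and "\<not> discrete_in (graph_aut_topology (bass_serre_tree A a))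
              (carrier (graph_aut_group (bass_serre_tree A a)))"
    and "unimodular (graph_aut_group (bass_serre_tree A a))
           (graph_aut_topology (bass_serre_tree A a))"
    and "finite_graph A"
    and "\<And>B. B \<in> local_subgroups A a \<Longrightarrow>
           covirtually_uniform_lattice isometry_group isometry_topology
             ((fundamental_group A a)\<lparr>carrier := B\<rparr>) (induced_hom A isometry_group \<psi>)"
    and "\<And>B. B \<in> local_subgroups A a \<Longrightarrow>
           acts_faithfully_on_tree A a
             (kernel ((fundamental_group A a)\<lparr>carrier := B\<rparr>) isometry_group
                (induced_hom A isometry_group \<psi>))"
  shows "group_quasi_isometric_to (fundamental_group A a)
           (UNIV \<times> realisation (bass_serre_tree A a))
           (l2_product_dist (dist :: 'x \<Rightarrow> 'x \<Rightarrow> real)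
              (realisation_dist (bass_serre_tree A a)))"
proof -
  interpret pointed_gog A a
    using assms(5,6) by unfold_locales (auto simp: graph_of_lattices_def)
  have "morphism_to_group A isometry_group \<psi>"
    using assms(5) by (simp add: graph_of_lattices_def)
  from product_action_geometric[OF assms(1,3) this assms(10,7) assms(11)[OF vertex_subgroup_local]]
  have "group_quasi_isometric_to (fundamental_group A a) (UNIV \<times> verts T)
      (l2_product_dist (dist :: 'x \<Rightarrow> 'x \<Rightarrow> real) (graph_dist T))"
    by (rule geometric_action.milnor_schwarz)
  then show ?thesis
    by (rule group_quasi_isometric_to_realisation[OF serre_tree connected_tree])
qed

end
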